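(* Let $1<\alpha\le 2$, $d,n\in\mathbb{N}$, let $X=\{X(t),t\in\mathbb{R}^d\}$ be an $\alpha$-stable random field of the form $X(t)=\int_E f_t(x)\,M(dx)$, where $M$ is an $\alpha$-stable random measure with control measure $m$ and $\int_E|f_t|^\alpha dm<\infty$ for each $t$, and let $\kappa$ be its covariation function. Let $t_1,\dots,t_n\in\mathbb{R}^d$ be distinct. Assume that the random vector $(X(t_1),\dots,X(t_n))^{\mathsf T}$ is full-dimensional and let $t_0\in\mathbb{R}^d$. Then the following holds for the Maximization of Covariation Linear (MCL) predictor based on $X(t_1),\dots,X(t_n)$: 1. The MCL predictor exists. 2. If additionally $\kappa(t_i,t_0)\ne 0$ for some $i\in\{1,\dots,n\}$, then the MCL predictor at $t_0$ is unique. 3. If the MCL predictor is unique, then it is exact. 4. If $\kappa(t_i,t_0)\ne0$ for some $i\in\{1,\dots,n\}$ and $\kappa$ is continuous, then the MCL predictor is continuous in $t_0$.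
   Context: Stable laws: for $1<\alpha\le 2$, $\sigma\ge 0$, $\beta\in[-1,1]$, $\mu\in\mathbb{R}$, $S_\alpha(\sigma,\beta,\mu)$ is the law with characteristic function $\theta\mapsto\exp\{-\sigma^\alpha|\theta|^\alpha(1-i\beta\,\mathrm{sign}(\theta)\tan(\pi\alpha/2))+i\mu\theta\}$; $\sigma_Z$ denotes the scale parameter $\sigma$ of an $\alpha$-stable random variable $Z$. Random measure and integral: let $(E,\mathcal{E},m)$ be a measure space, $\beta:E\to[-1,1]$ measurable, $\mathcal{E}_0=\{A\in\mathcal{E}:m(A)<\infty\}$. An $\alpha$-stable random measure $M$ with control measure $m$ and skewness $\beta$ is an independently scattered (values on disjoint sets are independent), a.s. $\sigma$-additive map from $\mathcal{E}_0$ to random variables with $M(A)\sim S_\alpha\big(m(A)^{1/\alpha},\int_A\beta\,dm/m(A),0\big)$. The integral $\int_E f\,dM$ is defined for measurable $f$ with $\int_E|f|^\alpha dm<\infty$ by approximation with simple functions; it is linear, and its scale parameter satisfies $\sigma^\alpha=\int_E|f|^\alpha dm$. Covariation: write $a^{<p>}=|a|^p\,\mathrm{sign}(a)$. For $U=\int_E g\,dM$, $V=\int_E h\,dM$ the covariation of $U$ on $V$ is $[U,V]_\alpha=\int_E g\,h^{<\alpha-1>}dm$ (equivalently $\int_{\mathbb{S}^1}s_1s_2^{<\alpha-1>}\Gamma(ds)$ with $\Gamma$ the spectral measure of $(U,V)^{\mathsf T}$). The covariation function of $X$ is $\kappa(s,t)=[X(s),X(t)]_\alpha=\int_E f_s f_t^{<\alpha-1>}dm$,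 $s,t\in\mathbb{R}^d$. MCL predictor: an MCL predictor of $X(t_0)$ is $\widehat{X(t_0)}=\sum_{i=1}^n\lambda_iX(t_i)$ whose weights $(\lambda_1,\dots,\lambda_n)\in\mathbb{R}^n$ solve the problem of maximizing $$[\widehat{X(t_0)},X(t_0)]_\alpha=\sum_{i=1}^n\lambda_i[X(t_i),X(t_0)]_\alpha$$ over $\lambda_1,\dots,\lambda_n$ subject to $\sigma_{\widehat{X(t_0)}}=\sigma_{X(t_0)}$. Unique at $t_0$ means that the maximizing weight vector is unique. Exact: $\widehat{X(t_0)}=X(t_0)$ a.s. whenever $t_0=t_i$ for some $i\in\{1,\dots,n\}$. Continuous in $t_0$: the MCL weights, considered as functions $t\mapsto\lambda_i(t)$, $i=1,\dots,n$, of the prediction location $t$, are continuous at $t=t_0$. Full-dimensional: an $\alpha$-stable random vector in $\mathbb{R}^n$ is full-dimensional if its spectral measure on the unit sphere $\mathbb{S}^{n-1}$ is not concentrated on the intersection of $\mathbb{S}^{n-1}$ with an $(n-1)$-dimensional linear subspace. The spectral measure $\Gamma$ is the finite measure on $\mathbb{S}^{n-1}$ in the characteristic function representation $\theta\mapsto\exp\{-\int_{\mathbb{S}^{n-1}}|\langle\theta,s\rangle|^\alpha(1-i\,\mathrm{sign}(\langle\theta,s\rangle)\tan\frac{\pi\alpha}{2})\Gamma(ds)+i\langle\theta,\mu\rangle\}$. For $\alpha=2$, full-dimensional means that the covariance matrix is nonsingular. *)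

theory Defs
  imports "HOL-Probability.Probability"
begin

section \<open>Stable laws\<close>

definition stable_char :: "real \<Rightarrow> real \<Rightarrow> real \<Rightarrow> real \<Rightarrow> real \<Rightarrow> complex" where
  "stable_char \<alpha> \<sigma> \<beta> \<mu> \<theta> =
     exp (- of_real (\<sigma> powr \<alpha> * \<bar>\<theta>\<bar> powr \<alpha>) *
            (1 - \<i> * of_real (\<beta> * sgn \<theta> * tan (pi * \<alpha> / 2)))
          + \<i> * of_real (\<mu> * \<theta>))"

definition has_stable_law ::
  "'w measure \<Rightarrow> ('w \<Rightarrow> real) \<Rightarrow> real \<Rightarrow> real \<Rightarrow> real \<Rightarrow> real \<Rightarrow> bool" where
  "has_stable_law P Z \<alpha> \<sigma> \<beta> \<mu> \<longleftrightarrow>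
     0 \<le> \<sigma> \<and> \<beta> \<in> {-1..1} \<and> Z \<in> borel_measurable P \<and>
     (\<forall>\<theta>. char (distr P borel Z) \<theta> = stable_char \<alpha> \<sigma> \<beta> \<mu> \<theta>)"

text \<open>The scale parameter is determined by the law (unlike the skewness, which is not
  identifiable if \<open>\<sigma> = 0\<close> or \<open>\<alpha> = 2\<close>), because the modulus of the characteristic function
  at \<open>1\<close> is \<open>exp (- (\<sigma> powr \<alpha>))\<close>. It is meaningful for stable \<open>Z\<close> only.\<close>

definition stable_scale :: "'w measure \<Rightarrow> real \<Rightarrow> ('w \<Rightarrow> real) \<Rightarrow> real" where
  "stable_scale P \<alpha> Z = (THE \<sigma>. \<exists>\<beta> \<mu>. has_stable_law P Z \<alpha> \<sigma> \<beta> \<mu>)"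

section \<open>Stable random measures and integrals\<close>

definition finite_sets :: "'e measure \<Rightarrow> 'e set set" where
  "finite_sets m = {A \<in> sets m. emeasure m A < \<infinity>}"

text \<open>If \<open>A\<close> is a null set, the skewness below is \<open>0 / 0 = 0\<close>; it is irrelevant, since the
  scale is then \<open>0\<close>. Independence on finite disjoint families is the special case of
  \<open>independently_scattered\<close> in which all but finitely many of the sets are empty.\<close>

locale stable_random_measure = prob_space P
  for P :: "'w measure" +
  fixes m :: "'e measure" and \<alpha> :: real and \<beta> :: "'e \<Rightarrow> real"
    and M :: "'e set \<Rightarrow> 'w \<Rightarrow> real"
  assumes index_gt_1: "1 < \<alpha>" and index_le_2: "\<alpha> \<le> 2"
    and skewness_measurable: "\<beta> \<in> borel_measurable m"
    and skewness_range: "\<And>x. x \<in> space m \<Longrightarrow> \<beta> x \<in> {-1..1}"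
    and stable_law:
      "\<And>A. A \<in> finite_sets m \<Longrightarrow>
         has_stable_law P (M A) \<alpha> (measure m A powr (1 / \<alpha>))
           ((LINT x:A|m. \<beta> x) / measure m A) 0"
    and independently_scattered:
      "\<And>A :: nat \<Rightarrow> 'e set. range A \<subseteq> finite_sets m \<Longrightarrow> disjoint_family A \<Longrightarrow>
         indep_vars (\<lambda>_. borel) (\<lambda>i. M (A i)) UNIV"
    and sigma_additive:
      "\<And>A :: nat \<Rightarrow> 'e set. range A \<subseteq> finite_sets m \<Longrightarrow> disjoint_family A \<Longrightarrow>
         (\<Union>i. A i) \<in> finite_sets m \<Longrightarrow>
         AE \<omega> in P. (\<lambda>i. M (A i) \<omega>) sums M (\<Union>i. A i) \<omega>"

definition tendsto_in_probability ::
  "'w measure \<Rightarrow> (nat \<Rightarrow> 'w \<Rightarrow> real) \<Rightarrow> ('w \<Rightarrow> real) \<Rightarrow> bool" where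
  "tendsto_in_probability P Y Z \<longleftrightarrow>
     (\<forall>\<epsilon>>0. (\<lambda>k. measure P {\<omega> \<in> space P. \<epsilon> < \<bar>Y k \<omega> - Z \<omega>\<bar>}) \<longlonglongrightarrow> 0)"

text \<open>The level set of \<open>0\<close> is left out, since it may have infinite control measure.\<close>

definition simple_stable_integral ::
  "'e measure \<Rightarrow> ('e set \<Rightarrow> 'w \<Rightarrow> real) \<Rightarrow> ('e \<Rightarrow> real) \<Rightarrow> 'w \<Rightarrow> real" where
  "simple_stable_integral m M g \<omega> =
     (\<Sum>c\<in>g ` space m - {0}. c * M {x \<in> space m. g x = c} \<omega>)"

definition Lalpha :: "'e measure \<Rightarrow> real \<Rightarrow> ('e \<Rightarrow> real) set" where
  "Lalpha m \<alpha> = {g \<in> borel_measurable m. (\<integral>\<^sup>+ x. ennreal (\<bar>g x\<bar> powr \<alpha>) \<partial>m) < \<infinity>}"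

text \<open>\<open>has_stable_integral P m \<alpha> M g Y\<close> says that the random variable \<open>Y\<close> is a version of
  the integral of \<open>g\<close> with respect to \<open>M\<close>. The integral is only determined almost surely;
  the limit does not depend on the approximating sequence.\<close>

definition has_stable_integral ::
  "'w measure \<Rightarrow> 'e measure \<Rightarrow> real \<Rightarrow> ('e set \<Rightarrow> 'w \<Rightarrow> real) \<Rightarrow>
     ('e \<Rightarrow> real) \<Rightarrow> ('w \<Rightarrow> real) \<Rightarrow> bool" where
  "has_stable_integral P m \<alpha> M g Y \<longleftrightarrow>
     g \<in> Lalpha m \<alpha> \<and> Y \<in> borel_measurable P \<and>
     (\<exists>s :: nat \<Rightarrow> 'e \<Rightarrow> real.
        (\<forall>k. Bochner_Integration.simple_bochner_integrable m (s k)) \<and>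
        (\<lambda>k. \<integral>\<^sup>+ x. ennreal (\<bar>s k x - g x\<bar> powr \<alpha>) \<partial>m) \<longlonglongrightarrow> 0 \<and>
        tendsto_in_probability P (\<lambda>k. simple_stable_integral m M (s k)) Y)"

section \<open>Covariation\<close>

definition signed_power :: "real \<Rightarrow> real \<Rightarrow> real" where
  "signed_power a p = \<bar>a\<bar> powr p * sgn a"

text \<open>The integrands \<open>g\<close> and \<open>h\<close> are determined almost everywhere by \<open>U\<close> and \<open>V\<close>, since the
  scale of the integral of \<open>g\<close> is the \<open>L\<^sup>\<alpha>\<close> norm of \<open>g\<close>; hence the value is unique.\<close>

definition covariation ::
  "'w measure \<Rightarrow> 'e measure \<Rightarrow> real \<Rightarrow> ('e set \<Rightarrow> 'w \<Rightarrow> real) \<Rightarrow>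
     ('w \<Rightarrow> real) \<Rightarrow> ('w \<Rightarrow> real) \<Rightarrow> real" where
  "covariation P m \<alpha> M U V =
     (THE c. \<exists>g h. has_stable_integral P m \<alpha> M g U \<and> has_stable_integral P m \<alpha> M h V \<and>
        c = (LINT x|m. g x * signed_power (h x) (\<alpha> - 1)))"

section \<open>Full-dimensional stable random vectors\<close>

definition is_spectral_measure ::
  "'w measure \<Rightarrow> real \<Rightarrow> ('w \<Rightarrow> real ^ 'n) \<Rightarrow> (real ^ 'n) measure \<Rightarrow> bool" where
  "is_spectral_measure P \<alpha> Y \<Gamma> \<longleftrightarrow>
     finite_measure \<Gamma> \<and> sets \<Gamma> = sets (restrict_space borel (sphere 0 1)) \<and>
     (\<exists>\<mu>. \<forall>\<theta>. (CLINT \<omega>|P. iexp (\<theta> \<bullet> Y \<omega>)) =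
        exp (- (CLINT s|\<Gamma>. of_real (\<bar>\<theta> \<bullet> s\<bar> powr \<alpha>) *
                  (1 - \<i> * of_real (sgn (\<theta> \<bullet> s) * tan (pi * \<alpha> / 2))))
             + \<i> * of_real (\<theta> \<bullet> \<mu>)))"

definition covariance_matrix :: "'w measure \<Rightarrow> ('w \<Rightarrow> real ^ 'n) \<Rightarrow> real ^ 'n ^ 'n" where
  "covariance_matrix P Y =
     (\<chi> i j. LINT \<omega>|P. (Y \<omega> $ i - (LINT \<omega>'|P. Y \<omega>' $ i)) * (Y \<omega> $ j - (LINT \<omega>'|P. Y \<omega>' $ j)))"

text \<open>For \<open>\<alpha> < 2\<close> the spectral measure is unique, so that the existential quantifier below
  just names it. For \<open>\<alpha> = 2\<close> it is not unique, hence the separate definition.\<close>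

definition full_dimensional ::
  "'w measure \<Rightarrow> real \<Rightarrow> ('w \<Rightarrow> real ^ 'n) \<Rightarrow> bool" where
  "full_dimensional P \<alpha> Y \<longleftrightarrow>
     Y \<in> borel_measurable P \<and>
     (if \<alpha> = 2 then invertible (covariance_matrix P Y)
      else \<exists>\<Gamma>. is_spectral_measure P \<alpha> Y \<Gamma> \<and>
             \<not> (\<exists>H. subspace H \<and> dim H = CARD('n) - 1 \<and>
                     emeasure \<Gamma> (sphere 0 1 - H) = 0))"

section \<open>The MCL predictor\<close>

definition linear_predictor ::
  "(real ^ 'd \<Rightarrow> 'w \<Rightarrow> real) \<Rightarrow> ('n::finite \<Rightarrow> real ^ 'd) \<Rightarrow> real ^ 'n \<Rightarrow> 'w \<Rightarrow> real" where
  "linear_predictor X t w \<omega> = (\<Sum>i\<in>UNIV. w $ i * X (t i) \<omega>)"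

definition is_mcl_weights ::
  "'w measure \<Rightarrow> 'e measure \<Rightarrow> real \<Rightarrow> ('e set \<Rightarrow> 'w \<Rightarrow> real) \<Rightarrow>
     (real ^ 'd \<Rightarrow> 'w \<Rightarrow> real) \<Rightarrow> ('n::finite \<Rightarrow> real ^ 'd) \<Rightarrow>
     real ^ 'd \<Rightarrow> real ^ 'n \<Rightarrow> bool" where
  "is_mcl_weights P m \<alpha> M X t t0 w \<longleftrightarrow>
     is_arg_max (\<lambda>v. covariation P m \<alpha> M (linear_predictor X t v) (X t0))
       (\<lambda>v. stable_scale P \<alpha> (linear_predictor X t v) = stable_scale P \<alpha> (X t0)) w"

end

theory Submission
  imports Defs
begin

text \<open>
  The integral is linear in its integrand, and the integral of \<open>g\<close> is stable with scale parameter
  \<open>(\<integral> \<bar>g\<bar>\<^sup>\<alpha> dm)\<close> to the power \<open>1 / \<alpha>\<close>, the \<open>L\<^sup>\<alpha>\<close> norm of \<open>g\<close>. Hence the scale of the predictor with weights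
  \<open>v\<close> is \<open>N v\<close>, the \<open>L\<^sup>\<alpha>\<close> norm of \<open>\<Sum>\<^sub>i v\<^sub>i f (t i)\<close>. Two integrands with the same integral differ by an
  integrand of the constant \<open>0\<close>, whose scale is \<open>0\<close>, so they agree almost everywhere. The
  covariation is therefore given by its integral formula, and the objective is the linear functional
  \<open>v \<mapsto> l \<bullet> v\<close> with \<open>l\<^sub>i = \<kappa> (t i) t0\<close>. The predictor thus maximizes a linear
  functional on the sphere \<open>N v = r\<close>, where \<open>r\<close> is the scale of \<open>X t0\<close>.

  Full dimension implies that \<open>N\<close> vanishes only at \<open>0\<close> (\<open>full_dimensional_nondegenerate\<close>):
  a predictor of scale \<open>0\<close> would be a linear relation between the observations, which
  makes the covariance matrix singular or concentrates the spectral measure on the hyperplane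
  orthogonal to the weights. So \<open>N\<close> is a norm, and it is strictly convex since \<open>\<alpha> > 1\<close>
  (\<open>predictor_norm\<close>). The rest is the geometry of strictly convex norms in finite dimension.

  A maximizer exists by compactness of the sphere. If \<open>l \<noteq> 0\<close>, two distinct maximizers would
  have a midpoint of the same value strictly inside the sphere, and rescaling it would
  give a larger value (\<open>maximizes_unique\<close>). Limits of maximizers are maximizers for the limiting
  data, so uniqueness gives continuity in \<open>(l, r)\<close> (\<open>maximizes_continuous\<close>), while
  \<open>l\<close> and \<open>r\<^sup>\<alpha> = \<kappa> t0 t0\<close> depend continuously on \<open>t0\<close> as soon as \<open>\<kappa>\<close> is continuous. Finally, if
  \<open>t0 = t i\<close>, the \<open>i\<close>-th unit vector is a maximizer by Young's
  inequality (\<open>integral_mult_signed_power_le\<close>), so it is the only one when the maximizer is unique, and its predictor is \<open>X (t i)\<close>.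
\<close>

section \<open>The space of \<open>\<alpha>\<close>-integrable functions\<close>

text \<open>The boundary point \<open>0\<close> has to be included, since integrands may vanish.\<close>

lemma convex_on_powr_nonneg:
  fixes p :: real
  assumes "1 \<le> p"
  shows "convex_on {0..} (\<lambda>x. x powr p)"
proof (rule convex_onI)
  fix u x y :: real
  assume u: "0 < u" "u < 1" and xy: "x \<in> {0..}" "y \<in> {0..}"
  have shrink: "(c * z) powr p \<le> c * z powr p" if "0 < c" "c < 1" "0 \<le> z" for c z :: real
  proof -
    have "c powr p \<le> c powr 1"
      using that assms by (intro powr_mono') auto
    then show ?thesis
      using that by (simp add: powr_mult mult_right_mono)
  qed
  show "((1 - u) *\<^sub>R x + u *\<^sub>R y) powr p \<le> (1 - u) * x powr p + u * y powr p"
  proof (cases "x = 0 \<or> y = 0")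
    case True
    then show ?thesis
      using shrink[of u y] shrink[of "1 - u" x] u xy by auto
  next
    case False
    then show ?thesis
      using convex_onD[OF powr_convex[OF assms], of u x y] u xy by auto
  qed
qed (rule convex_real_interval)

text \<open>This is convexity of the power function at the points \<open>\<bar>a\<bar> / p\<close> and \<open>\<bar>b\<bar> / q\<close>. It holds
  pointwise for all \<open>p\<close> and \<open>q\<close>, which can thus be chosen after integrating.\<close>

lemma powr_add_le_weighted:
  fixes \<alpha> p q a b :: real
  assumes \<alpha>: "1 < \<alpha>" and pq: "0 < p" "0 < q"
  shows "\<bar>a + b\<bar> powr \<alpha>
    \<le> (p + q) powr (\<alpha> - 1) * (\<bar>a\<bar> powr \<alpha> / p powr (\<alpha> - 1) + \<bar>b\<bar> powr \<alpha> / q powr (\<alpha> - 1))"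
proof -
  let ?u = "q / (p + q)"
  have u: "0 \<le> ?u" "?u \<le> 1" and u': "1 - ?u = p / (p + q)"
    using pq by (auto simp: field_simps)
  have mix: "(1 - ?u) *\<^sub>R (\<bar>a\<bar> / p) + ?u *\<^sub>R (\<bar>b\<bar> / q) = (\<bar>a\<bar> + \<bar>b\<bar>) / (p + q)"
    unfolding u' using pq by (simp add: add_divide_distrib)
  have pq': "p + q \<noteq> 0" using pq by simp
  have div: "(x / y) powr \<alpha> * y = x powr \<alpha> / y powr (\<alpha> - 1)" if "0 \<le> x" "0 < y" for x y :: real
    using that by (simp add: powr_divide powr_diff)
  have "((\<bar>a\<bar> + \<bar>b\<bar>) / (p + q)) powr \<alpha>
      \<le> (1 - ?u) * (\<bar>a\<bar> / p) powr \<alpha> + ?u * (\<bar>b\<bar> / q) powr \<alpha>"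
    using convex_onD[OF convex_on_powr_nonneg, of \<alpha> ?u "\<bar>a\<bar> / p" "\<bar>b\<bar> / q"] \<alpha> pq u
    unfolding mix by auto
  then have "((\<bar>a\<bar> + \<bar>b\<bar>) / (p + q)) powr \<alpha> * (p + q)
      \<le> ((1 - ?u) * (\<bar>a\<bar> / p) powr \<alpha> + ?u * (\<bar>b\<bar> / q) powr \<alpha>) * (p + q)"
    using pq by (intro mult_right_mono) auto
  also have "\<dots> = (\<bar>a\<bar> / p) powr \<alpha> * p + (\<bar>b\<bar> / q) powr \<alpha> * q"
    unfolding u' using pq' by (simp add: distrib_right)
  finally have "(\<bar>a\<bar> + \<bar>b\<bar>) powr \<alpha> / (p + q) powr (\<alpha> - 1)
      \<le> \<bar>a\<bar> powr \<alpha> / p powr (\<alpha> - 1) + \<bar>b\<bar> powr \<alpha> / q powr (\<alpha> - 1)"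
    using pq by (simp only: div abs_ge_zero add_nonneg_nonneg add_pos_pos)
  then have "(\<bar>a\<bar> + \<bar>b\<bar>) powr \<alpha>
    \<le> (p + q) powr (\<alpha> - 1) * (\<bar>a\<bar> powr \<alpha> / p powr (\<alpha> - 1) + \<bar>b\<bar> powr \<alpha> / q powr (\<alpha> - 1))"
    using pq by (simp add: pos_divide_le_eq mult.commute)
  moreover have "\<bar>a + b\<bar> powr \<alpha> \<le> (\<bar>a\<bar> + \<bar>b\<bar>) powr \<alpha>"
    using \<alpha> by (intro powr_mono2) auto
  ultimately show ?thesis by linarith
qed

text \<open>The increments over the two halves of the interval are compared by the mean value theorem: the
  derivative is strictly increasing because \<open>\<alpha> > 1\<close>.\<close>

lemma powr_strict_midpoint_nonneg:
  fixes \<alpha> a b :: real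
  assumes \<alpha>: "1 < \<alpha>" and ab: "0 \<le> a" "a < b"
  shows "2 * ((a + b) / 2) powr \<alpha> < a powr \<alpha> + b powr \<alpha>"
proof -
  let ?c = "(a + b) / 2"
  have slope: "\<exists>z. x < z \<and> z < y \<and> y powr \<alpha> - x powr \<alpha> = \<alpha> * z powr (\<alpha> - 1) * (y - x)"
    if "0 \<le> x" "x < y" for x y :: real
  proof (rule mvt[OF that(2)])
    show "continuous_on {x..y} (\<lambda>x. x powr \<alpha>)"
      using that \<alpha> by (intro continuous_on_powr' continuous_intros) auto
    show "((\<lambda>x. x powr \<alpha>) has_derivative (*) (\<alpha> * z powr (\<alpha> - 1))) (at z)" if "x < z" for z
      using has_real_derivative_powr[of z \<alpha>] that \<open>0 \<le> x\<close>
      by (simp add: has_field_derivative_def)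
  qed blast
  obtain z where z: "a < z" "z < ?c" "?c powr \<alpha> - a powr \<alpha> = \<alpha> * z powr (\<alpha> - 1) * (?c - a)"
    using slope[of a ?c] ab by auto
  obtain z' where z': "?c < z'" "b powr \<alpha> - ?c powr \<alpha> = \<alpha> * z' powr (\<alpha> - 1) * (b - ?c)"
    using slope[of ?c b] ab by auto
  have half: "?c - a = (b - a) / 2" "b - ?c = (b - a) / 2"
    by (auto simp: field_simps)
  have "z powr (\<alpha> - 1) < z' powr (\<alpha> - 1)"
    using z z' ab \<alpha> by (intro powr_less_mono2) auto
  then have "\<alpha> * z powr (\<alpha> - 1) * ((b - a) / 2) < \<alpha> * z' powr (\<alpha> - 1) * ((b - a) / 2)"
    using \<alpha> ab by (intro mult_strict_right_mono mult_strict_left_mono) auto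
  then show ?thesis
    using z(3) z'(2) unfolding half by linarith
qed

lemma abs_powr_strict_midpoint:
  fixes \<alpha> a b :: real
  assumes \<alpha>: "1 < \<alpha>" and ab: "a \<noteq> b"
  shows "2 * \<bar>(a + b) / 2\<bar> powr \<alpha> < \<bar>a\<bar> powr \<alpha> + \<bar>b\<bar> powr \<alpha>"
proof (cases "\<bar>a\<bar> = \<bar>b\<bar>")
  case True
  then have "b = - a" "a \<noteq> 0" using ab by (auto simp: abs_eq_iff)
  then show ?thesis using \<alpha> by simp
next
  case False
  have "\<bar>(a + b) / 2\<bar> powr \<alpha> \<le> ((\<bar>a\<bar> + \<bar>b\<bar>) / 2) powr \<alpha>"
    using \<alpha> by (intro powr_mono2) auto
  moreover have "2 * ((\<bar>a\<bar> + \<bar>b\<bar>) / 2) powr \<alpha> < \<bar>a\<bar> powr \<alpha> + \<bar>b\<bar> powr \<alpha>"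
  proof (cases "\<bar>a\<bar> < \<bar>b\<bar>")
    case True
    then show ?thesis using powr_strict_midpoint_nonneg[OF \<alpha>, of "\<bar>a\<bar>" "\<bar>b\<bar>"] by simp
  next
    case gt: False
    then show ?thesis
      using powr_strict_midpoint_nonneg[OF \<alpha>, of "\<bar>b\<bar>" "\<bar>a\<bar>"] False by (simp add: add.commute)
  qed
  ultimately show ?thesis by linarith
qed

lemma Lalpha_iff:
  "g \<in> Lalpha m \<alpha> \<longleftrightarrow> g \<in> borel_measurable m \<and> integrable m (\<lambda>x. \<bar>g x\<bar> powr \<alpha>)"
  by (auto simp: Lalpha_def integrable_iff_bounded)

lemma Lalpha_measurable [measurable_dest]: "g \<in> Lalpha m \<alpha> \<Longrightarrow> g \<in> borel_measurable m"
  by (simp add: Lalpha_iff)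

lemma Lalpha_integrable: "g \<in> Lalpha m \<alpha> \<Longrightarrow> integrable m (\<lambda>x. \<bar>g x\<bar> powr \<alpha>)"
  by (simp add: Lalpha_iff)

lemma Lalpha_scale: "g \<in> Lalpha m \<alpha> \<Longrightarrow> (\<lambda>x. c * g x) \<in> Lalpha m \<alpha>"
  by (auto simp: Lalpha_iff abs_mult powr_mult)

lemma Lalpha_add:
  assumes "1 < \<alpha>" and [measurable]: "g \<in> Lalpha m \<alpha>" "h \<in> Lalpha m \<alpha>"
  shows "(\<lambda>x. g x + h x) \<in> Lalpha m \<alpha>"
  unfolding Lalpha_iff
proof
  show "integrable m (\<lambda>x. \<bar>g x + h x\<bar> powr \<alpha>)"
  proof (rule Bochner_Integration.integrable_bound)
    show "integrable m (\<lambda>x. (1 + 1) powr (\<alpha> - 1)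
        * (\<bar>g x\<bar> powr \<alpha> / 1 powr (\<alpha> - 1) + \<bar>h x\<bar> powr \<alpha> / 1 powr (\<alpha> - 1)))"
      using assms by (auto intro!: Lalpha_integrable)
    show "AE x in m. norm (\<bar>g x + h x\<bar> powr \<alpha>) \<le> norm ((1 + 1) powr (\<alpha> - 1)
        * (\<bar>g x\<bar> powr \<alpha> / 1 powr (\<alpha> - 1) + \<bar>h x\<bar> powr \<alpha> / 1 powr (\<alpha> - 1)))"
      using powr_add_le_weighted[OF assms(1), of 1 1] by (intro AE_I2) (force simp: abs_mult)
  qed measurable
qed measurable

lemma Lalpha_zero: "(\<lambda>_. 0) \<in> Lalpha m \<alpha>"
  by (simp add: Lalpha_iff)

lemma Lalpha_diff:
  assumes "1 < \<alpha>" "g \<in> Lalpha m \<alpha>" "h \<in> Lalpha m \<alpha>"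
  shows "(\<lambda>x. g x - h x) \<in> Lalpha m \<alpha>"
  using Lalpha_add[OF assms(1,2) Lalpha_scale[OF assms(3), of "-1"]] by simp

definition Lnorm :: "'e measure \<Rightarrow> real \<Rightarrow> ('e \<Rightarrow> real) \<Rightarrow> real" where
  "Lnorm m \<alpha> g = (LINT x|m. \<bar>g x\<bar> powr \<alpha>) powr (1 / \<alpha>)"

lemma Lnorm_nonneg [simp]: "0 \<le> Lnorm m \<alpha> g"
  by (simp add: Lnorm_def)

lemma Lnorm_powr: "1 < \<alpha> \<Longrightarrow> Lnorm m \<alpha> g powr \<alpha> = (LINT x|m. \<bar>g x\<bar> powr \<alpha>)"
  by (simp add: Lnorm_def powr_powr)

lemma Lnorm_scale: "1 < \<alpha> \<Longrightarrow> Lnorm m \<alpha> (\<lambda>x. c * g x) = \<bar>c\<bar> * Lnorm m \<alpha> g"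
  by (simp add: Lnorm_def abs_mult powr_mult powr_powr)

lemma Lnorm_eq_0_iff:
  assumes "1 < \<alpha>" "g \<in> Lalpha m \<alpha>"
  shows "Lnorm m \<alpha> g = 0 \<longleftrightarrow> (AE x in m. g x = 0)"
  using integral_nonneg_eq_0_iff_AE[OF Lalpha_integrable[OF assms(2)]] assms(1)
  by (simp add: Lnorm_def)

lemma Lnorm_cong_AE:
  assumes [measurable]: "g \<in> borel_measurable m" "h \<in> borel_measurable m"
    and eq: "AE x in m. g x = h x"
  shows "Lnorm m \<alpha> g = Lnorm m \<alpha> h"
proof -
  have "(LINT x|m. \<bar>g x\<bar> powr \<alpha>) = (LINT x|m. \<bar>h x\<bar> powr \<alpha>)"
    by (rule integral_cong_AE) (use eq in auto)
  then show ?thesis by (simp add: Lnorm_def)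
qed

text \<open>Minkowski's inequality is the weighted convexity inequality, integrated with the two norms
  themselves as weights.\<close>

lemma Lnorm_triangle:
  assumes \<alpha>: "1 < \<alpha>" and g: "g \<in> Lalpha m \<alpha>" and h: "h \<in> Lalpha m \<alpha>"
  shows "Lnorm m \<alpha> (\<lambda>x. g x + h x) \<le> Lnorm m \<alpha> g + Lnorm m \<alpha> h"
proof -
  note [measurable] = Lalpha_measurable[OF g] Lalpha_measurable[OF h]
  let ?p = "Lnorm m \<alpha> g" and ?q = "Lnorm m \<alpha> h"
  show ?thesis
  proof (cases "?p = 0 \<or> ?q = 0")
    case True
    then show ?thesis
    proof
      assume z: "?p = 0"
      then have "AE x in m. g x + h x = h x"
        using Lnorm_eq_0_iff[OF \<alpha> g] by auto
      then show ?thesis using z Lnorm_cong_AE[of "\<lambda>x. g x + h x" m h \<alpha>] by simp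
    next
      assume z: "?q = 0"
      then have "AE x in m. g x + h x = g x"
        using Lnorm_eq_0_iff[OF \<alpha> h] by auto
      then show ?thesis using z Lnorm_cong_AE[of "\<lambda>x. g x + h x" m g \<alpha>] by simp
    qed
  next
    case False
    then have p: "0 < ?p" and q: "0 < ?q"
      using Lnorm_nonneg[of m \<alpha> g] Lnorm_nonneg[of m \<alpha> h] by linarith+
    have quot: "r powr \<alpha> / r powr (\<alpha> - 1) = r" if "0 < r" for r :: real
      using that by (simp add: powr_diff)
    have "(LINT x|m. \<bar>g x + h x\<bar> powr \<alpha>) \<le> (LINT x|m. (?p + ?q) powr (\<alpha> - 1)
        * (\<bar>g x\<bar> powr \<alpha> / ?p powr (\<alpha> - 1) + \<bar>h x\<bar> powr \<alpha> / ?q powr (\<alpha> - 1)))"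
      using Lalpha_integrable[OF g] Lalpha_integrable[OF h]
        Lalpha_integrable[OF Lalpha_add[OF \<alpha> g h]] powr_add_le_weighted[OF \<alpha> p q]
      by (intro integral_mono) auto
    also have "\<dots> = (?p + ?q) powr (\<alpha> - 1)
        * (?p powr \<alpha> / ?p powr (\<alpha> - 1) + ?q powr \<alpha> / ?q powr (\<alpha> - 1))"
      using Lalpha_integrable[OF g] Lalpha_integrable[OF h] by (simp add: Lnorm_powr[OF \<alpha>])
    also have "\<dots> = (?p + ?q) powr \<alpha>"
      unfolding quot[OF p] quot[OF q] using p q by (simp add: powr_diff)
    finally have "Lnorm m \<alpha> (\<lambda>x. g x + h x) \<le> ((?p + ?q) powr \<alpha>) powr (1 / \<alpha>)"
      unfolding Lnorm_def[of m \<alpha> "\<lambda>x. g x + h x"] using \<alpha> by (intro powr_mono2) auto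
    also have "\<dots> = ?p + ?q" using \<alpha> p q by (simp add: powr_powr)
    finally show ?thesis .
  qed
qed

lemma Lnorm_diff_triangle:
  assumes \<alpha>: "1 < \<alpha>" and g: "g \<in> Lalpha m \<alpha>" and h: "h \<in> Lalpha m \<alpha>"
  shows "\<bar>Lnorm m \<alpha> g - Lnorm m \<alpha> h\<bar> \<le> Lnorm m \<alpha> (\<lambda>x. g x - h x)"
proof -
  have "Lnorm m \<alpha> (\<lambda>x. h x - g x) = Lnorm m \<alpha> (\<lambda>x. g x - h x)"
    using Lnorm_scale[OF \<alpha>, of m "-1" "\<lambda>x. g x - h x"] by simp
  then show ?thesis
    using Lnorm_triangle[OF \<alpha> Lalpha_diff[OF \<alpha> g h] h] Lnorm_triangle[OF \<alpha> Lalpha_diff[OF \<alpha> h g] g]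
    by auto
qed

text \<open>The convexity gap of the power function at the midpoint is nonnegative, and positive wherever
  \<open>g\<close> and \<open>h\<close> differ. If they differ on a set of positive measure, the gap has a positive integral.\<close>

lemma Lnorm_strict_convex:
  assumes \<alpha>: "1 < \<alpha>" and g: "g \<in> Lalpha m \<alpha>" and h: "h \<in> Lalpha m \<alpha>"
    and eq: "Lnorm m \<alpha> g = Lnorm m \<alpha> h" and ne: "Lnorm m \<alpha> (\<lambda>x. g x - h x) \<noteq> 0"
  shows "Lnorm m \<alpha> (\<lambda>x. g x + h x) < 2 * Lnorm m \<alpha> g"
proof -
  let ?mid = "\<lambda>x. \<bar>(g x + h x) / 2\<bar> powr \<alpha>"
  let ?gap = "\<lambda>x. \<bar>g x\<bar> powr \<alpha> + \<bar>h x\<bar> powr \<alpha> - 2 * ?mid x"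
  have mid: "(\<lambda>x. (g x + h x) / 2) \<in> Lalpha m \<alpha>"
    using Lalpha_scale[OF Lalpha_add[OF \<alpha> g h], of "1 / 2"] by simp
  note int = Lalpha_integrable[OF g] Lalpha_integrable[OF h] Lalpha_integrable[OF mid]
  have gap_pos: "0 < ?gap x" if "g x \<noteq> h x" for x
    using abs_powr_strict_midpoint[OF \<alpha> that] by simp
  have gap_nonneg: "0 \<le> ?gap x" for x
    using gap_pos[of x] by (cases "g x = h x") auto
  have int_gap: "integrable m ?gap" using int by auto
  have "(LINT x|m. ?gap x) \<noteq> 0"
  proof
    assume "(LINT x|m. ?gap x) = 0"
    then have "AE x in m. ?gap x = 0"
      using integral_nonneg_eq_0_iff_AE[OF int_gap] gap_nonneg by auto
    then have "AE x in m. g x - h x = 0"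
      using gap_pos by (auto elim!: eventually_mono simp: less_le)
    then show False
      using ne Lnorm_eq_0_iff[OF \<alpha> Lalpha_diff[OF \<alpha> g h]] by simp
  qed
  then have "0 < (LINT x|m. ?gap x)"
    using Bochner_Integration.integral_nonneg[of m ?gap, OF gap_nonneg] by linarith
  also have "(LINT x|m. ?gap x) = 2 * Lnorm m \<alpha> g powr \<alpha> - 2 * (LINT x|m. ?mid x)"
    using int eq by (simp add: Lnorm_powr[OF \<alpha>, symmetric])
  finally have "(LINT x|m. ?mid x) powr (1 / \<alpha>) < (Lnorm m \<alpha> g powr \<alpha>) powr (1 / \<alpha>)"
    using \<alpha> by (intro powr_less_mono2) auto
  then have "Lnorm m \<alpha> (\<lambda>x. (g x + h x) / 2) < Lnorm m \<alpha> g"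
    using \<alpha> by (simp add: powr_powr Lnorm_def[of m \<alpha> "\<lambda>x. (g x + h x) / 2"])
  moreover have "Lnorm m \<alpha> (\<lambda>x. (g x + h x) / 2) = Lnorm m \<alpha> (\<lambda>x. g x + h x) / 2"
    using Lnorm_scale[OF \<alpha>, of m "1 / 2" "\<lambda>x. g x + h x"] by simp
  ultimately show ?thesis by simp
qed

lemma signed_power_measurable [measurable]:
  assumes [measurable]: "h \<in> borel_measurable m"
  shows "(\<lambda>x. signed_power (h x) p) \<in> borel_measurable m"
  unfolding signed_power_def sgn_if by measurable

text \<open>Young's inequality with exponents \<open>\<alpha>\<close> and \<open>\<alpha> / (\<alpha> - 1)\<close>. It gives both the integrability of the
  covariation integrand and the bound on it for two functions of equal norm, where it is as sharp as
  Hoelder's inequality.\<close>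

lemma young_powr:
  fixes a b \<alpha> :: real
  assumes \<alpha>: "1 < \<alpha>"
  shows "\<bar>a * signed_power b (\<alpha> - 1)\<bar> \<le> \<bar>a\<bar> powr \<alpha> / \<alpha> + (1 - 1 / \<alpha>) * \<bar>b\<bar> powr \<alpha>"
proof -
  let ?q = "\<alpha> / (\<alpha> - 1)"
  have "\<bar>a\<bar> * \<bar>b\<bar> powr (\<alpha> - 1) \<le> \<bar>a\<bar> powr \<alpha> / \<alpha> + (\<bar>b\<bar> powr (\<alpha> - 1)) powr ?q / ?q"
    using \<alpha> by (intro Youngs_inequality) (auto simp: field_simps)
  also have "(\<bar>b\<bar> powr (\<alpha> - 1)) powr ?q / ?q = (1 - 1 / \<alpha>) * \<bar>b\<bar> powr \<alpha>"
    using \<alpha> by (simp add: powr_powr) (simp add: divide_simps)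
  finally show ?thesis
    by (cases "b = 0") (simp_all add: signed_power_def abs_mult abs_sgn_eq)
qed

lemma integrable_mult_signed_power:
  assumes \<alpha>: "1 < \<alpha>" and g: "g \<in> Lalpha m \<alpha>" and h: "h \<in> Lalpha m \<alpha>"
  shows "integrable m (\<lambda>x. g x * signed_power (h x) (\<alpha> - 1))"
proof (rule Bochner_Integration.integrable_bound)
  note [measurable] = Lalpha_measurable[OF g] Lalpha_measurable[OF h]
  show "integrable m (\<lambda>x. \<bar>g x\<bar> powr \<alpha> / \<alpha> + (1 - 1 / \<alpha>) * \<bar>h x\<bar> powr \<alpha>)"
    using Lalpha_integrable[OF g] Lalpha_integrable[OF h] by auto
  show "(\<lambda>x. g x * signed_power (h x) (\<alpha> - 1)) \<in> borel_measurable m" by measurable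
  show "AE x in m. norm (g x * signed_power (h x) (\<alpha> - 1))
      \<le> norm (\<bar>g x\<bar> powr \<alpha> / \<alpha> + (1 - 1 / \<alpha>) * \<bar>h x\<bar> powr \<alpha>)"
    using order_trans[OF young_powr[OF \<alpha>] abs_ge_self] by (intro AE_I2) simp
qed

lemma integral_mult_signed_power_le:
  assumes \<alpha>: "1 < \<alpha>" and g: "g \<in> Lalpha m \<alpha>" and h: "h \<in> Lalpha m \<alpha>"
    and eq: "Lnorm m \<alpha> g = Lnorm m \<alpha> h"
  shows "(LINT x|m. g x * signed_power (h x) (\<alpha> - 1)) \<le> Lnorm m \<alpha> h powr \<alpha>"
proof -
  have "(LINT x|m. g x * signed_power (h x) (\<alpha> - 1))
      \<le> (LINT x|m. \<bar>g x\<bar> powr \<alpha> / \<alpha> + (1 - 1 / \<alpha>) * \<bar>h x\<bar> powr \<alpha>)"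
    using Lalpha_integrable[OF g] Lalpha_integrable[OF h] young_powr[OF \<alpha>]
    by (intro integral_mono integrable_mult_signed_power[OF \<alpha> g h]) (auto intro: abs_le_D1)
  also have "\<dots> = Lnorm m \<alpha> g powr \<alpha> / \<alpha> + (1 - 1 / \<alpha>) * Lnorm m \<alpha> h powr \<alpha>"
    using Lalpha_integrable[OF g] Lalpha_integrable[OF h] by (simp add: Lnorm_powr[OF \<alpha>])
  also have "\<dots> = Lnorm m \<alpha> h powr \<alpha>"
    using \<alpha> unfolding eq by (simp add: field_simps)
  finally show ?thesis .
qed

lemma integral_self_signed_power:
  "1 < \<alpha> \<Longrightarrow> (LINT x|m. h x * signed_power (h x) (\<alpha> - 1)) = Lnorm m \<alpha> h powr \<alpha>"
proof -
  assume \<alpha>: "1 < \<alpha>"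
  have "b * signed_power b (\<alpha> - 1) = \<bar>b\<bar> powr \<alpha>" for b :: real
    by (cases "b = 0") (auto simp: signed_power_def powr_diff sgn_if)
  then show ?thesis by (simp add: Lnorm_powr[OF \<alpha>])
qed


section \<open>Linear functionals on the spheres of a strictly convex norm\<close>

lemma bounded_seq_tendsto_unique_cluster_point:
  fixes y :: "nat \<Rightarrow> 'a::heine_borel"
  assumes bdd: "bounded (range y)"
    and cluster: "\<And>\<rho> z. strict_mono \<rho> \<Longrightarrow> (y \<circ> \<rho>) \<longlonglongrightarrow> z \<Longrightarrow> z = L"
  shows "y \<longlonglongrightarrow> L"
proof (rule ccontr)
  assume "\<not> y \<longlonglongrightarrow> L"
  then obtain \<epsilon> where \<epsilon>: "0 < \<epsilon>" and "\<not> (\<exists>n0. \<forall>n\<ge>n0. dist (y n) L < \<epsilon>)"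
    unfolding lim_sequentially by auto
  then have "infinite {n. \<epsilon> \<le> dist (y n) L}"
    unfolding infinite_nat_iff_unbounded_le by (auto simp: not_less)
  then obtain \<rho> :: "nat \<Rightarrow> nat" where \<rho>: "strict_mono \<rho>" "\<And>k. \<epsilon> \<le> dist (y (\<rho> k)) L"
    using infinite_enumerate[of "{n. \<epsilon> \<le> dist (y n) L}"] by auto
  have "bounded (range (y \<circ> \<rho>))"
    by (rule bounded_subset[OF bdd]) auto
  then obtain z \<tau> where z: "strict_mono \<tau>" "((y \<circ> \<rho>) \<circ> \<tau>) \<longlonglongrightarrow> z"
    using bounded_imp_convergent_subsequence by blast
  have "z = L"
    using cluster[of "\<rho> \<circ> \<tau>" z] z \<rho> by (simp add: strict_mono_o comp_assoc)
  then have "(\<lambda>k. dist (y (\<rho> (\<tau> k))) L) \<longlonglongrightarrow> 0"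
    using z(2) by (simp add: tendsto_dist_iff[symmetric] comp_def)
  then have "\<epsilon> \<le> 0"
    by (rule LIMSEQ_le_const) (use \<rho> in auto)
  with \<epsilon> show False by simp
qed

locale strictly_convex_norm =
  fixes N :: "'a::euclidean_space \<Rightarrow> real"
  assumes scale: "N (c *\<^sub>R v) = \<bar>c\<bar> * N v"
    and triangle: "N (u + v) \<le> N u + N v"
    and pos: "v \<noteq> 0 \<Longrightarrow> 0 < N v"
    and strict: "N u = N v \<Longrightarrow> u \<noteq> v \<Longrightarrow> N (u + v) < 2 * N u"
begin

lemma zero [simp]: "N 0 = 0"
  using scale[of 0 0] by simp

lemma nonneg [simp]: "0 \<le> N v"
  using pos[of v] by (cases "v = 0") auto

lemma eq_0_iff [simp]: "N v = 0 \<longleftrightarrow> v = 0"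
  using pos[of v] by (cases "v = 0") auto

lemma continuous: "continuous_on UNIV N"
proof (rule convex_on_continuous)
  show "convex_on UNIV N"
  proof (rule convex_onI)
    fix c :: real and u v
    assume "0 < c" "c < 1"
    then show "N ((1 - c) *\<^sub>R u + c *\<^sub>R v) \<le> (1 - c) * N u + c * N v"
      using triangle[of "(1 - c) *\<^sub>R u" "c *\<^sub>R v"] by (simp add: scale)
  qed simp
qed simp

lemma tendsto: "(v \<longlongrightarrow> z) F \<Longrightarrow> ((\<lambda>k. N (v k)) \<longlongrightarrow> N z) F"
  using continuous_on_tendsto_compose[OF continuous] by simp

text \<open>The constant is the minimum of \<open>N\<close> on the Euclidean unit sphere. It makes the spheres of \<open>N\<close>
  bounded.\<close>

lemma dominates_norm:
  obtains \<delta> where "0 < \<delta>" "\<And>v. \<delta> * norm v \<le> N v"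
proof -
  obtain b :: 'a where "b \<in> Basis" using nonempty_Basis by blast
  then have "sphere (0::'a) 1 \<noteq> {}" by force
  then obtain e where e: "e \<in> sphere 0 1" "\<And>v. v \<in> sphere 0 1 \<Longrightarrow> N e \<le> N v"
    using continuous_attains_inf[of "sphere 0 1" N] continuous_on_subset[OF continuous] by auto
  show thesis
  proof
    show "0 < N e" using e by (intro pos) auto
    fix v :: 'a
    show "N e * norm v \<le> N v"
    proof (cases "v = 0")
      case False
      have "N e \<le> N ((1 / norm v) *\<^sub>R v)"
        using False by (intro e(2)) auto
      then show ?thesis
        using False by (simp add: scale field_simps)
    qed simp
  qed
qed

definition maximizes :: "'a \<Rightarrow> real \<Rightarrow> 'a \<Rightarrow> bool" where
  "maximizes l r w \<longleftrightarrow> is_arg_max (\<lambda>v. l \<bullet> v) (\<lambda>v. N v = r) w"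

lemma maximizes_iff: "maximizes l r w \<longleftrightarrow> N w = r \<and> (\<forall>v. N v = r \<longrightarrow> l \<bullet> v \<le> l \<bullet> w)"
  by (auto simp: maximizes_def is_arg_max_linorder)

lemma ex_maximizes:
  assumes "0 \<le> r"
  shows "\<exists>w. maximizes l r w"
proof -
  obtain \<delta> where \<delta>: "0 < \<delta>" "\<And>v. \<delta> * norm v \<le> N v" using dominates_norm by blast
  let ?S = "{v. N v = r}"
  have "bounded ?S"
    using \<delta> by (intro boundedI[of _ "r / \<delta>"]) (auto simp: field_simps)
  moreover have "closed ?S"
    using continuous_closed_preimage_constant[OF continuous closed_UNIV] by simp
  ultimately have "compact ?S" by (simp add: compact_eq_bounded_closed)
  moreover have "?S \<noteq> {}"
  proof -
    obtain b :: 'a where "b \<in> Basis" using nonempty_Basis by blast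
    then have "N ((r / N b) *\<^sub>R b) = r"
      using assms by (auto simp: scale)
    then show ?thesis by blast
  qed
  moreover have "continuous_on ?S (\<lambda>v. l \<bullet> v)" by (intro continuous_intros)
  ultimately have "\<exists>w\<in>?S. \<forall>v\<in>?S. l \<bullet> v \<le> l \<bullet> w"
    by (rule continuous_attains_sup)
  then show ?thesis by (auto simp: maximizes_iff)
qed

text \<open>The value on the sphere is positive, since \<open>l\<close> itself can be rescaled to a competitor. The sum of
  two distinct maximizers has twice this value but, by strict convexity, less than twice the norm, so
  rescaling the sum to the sphere improves on the maximum.\<close>

lemma maximizes_unique:
  assumes u: "maximizes l r u" and v: "maximizes l r v" and ne: "l \<noteq> 0 \<or> r = 0"
  shows "u = v"
proof (rule ccontr)
  assume uv: "u \<noteq> v"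
  have r: "0 < r"
  proof (rule ccontr)
    assume "\<not> 0 < r"
    then have "r = 0" using u nonneg[of u] unfolding maximizes_iff by linarith
    then show False using u v uv by (simp add: maximizes_iff)
  qed
  then have l: "l \<noteq> 0" using ne by auto
  have val: "l \<bullet> ((r / N z) *\<^sub>R z) \<le> l \<bullet> u" if "z \<noteq> 0" for z
  proof -
    have "N ((r / N z) *\<^sub>R z) = r" using that r by (simp add: scale)
    then show ?thesis using u unfolding maximizes_iff by blast
  qed
  have "l \<bullet> u > 0"
    using val[OF l] l r pos[OF l] by (intro less_le_trans[OF _ val[OF l]]) (auto simp: zero_less_mult_iff)
  moreover have "l \<bullet> u = l \<bullet> v"
    using u v unfolding maximizes_iff by (intro antisym) auto
  ultimately have z1: "l \<bullet> (u + v) = 2 * (l \<bullet> u)"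
    by (simp add: inner_add_right)
  have z2: "u + v \<noteq> 0"
  proof
    assume "u + v = 0"
    then show False using z1 \<open>0 < l \<bullet> u\<close> by simp
  qed
  have "N (u + v) < 2 * r"
    using strict[of u v] u v uv by (simp add: maximizes_iff)
  then have "l \<bullet> u < r / N (u + v) * (2 * (l \<bullet> u))"
    using \<open>0 < l \<bullet> u\<close> pos[OF z2] by (simp add: field_simps)
  then show False
    using val[OF z2] z1 by simp
qed

text \<open>Continuity of the maximizer in the data. A cluster point of maximizers at nearby
  parameters beats every competitor \<open>v\<close> at the limiting parameter, because \<open>v\<close> can be rescaled to
  competitors on the nearby spheres. Uniqueness then identifies all cluster points.\<close>

lemma maximizes_continuous:
  fixes l :: "'s::metric_space \<Rightarrow> 'a"
  assumes max: "\<And>s. maximizes (l s) (r s) (w s)"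
    and l: "isCont l s0" and r: "isCont r s0" and ne: "l s0 \<noteq> 0 \<or> r s0 = 0"
  shows "isCont w s0"
  unfolding continuous_at_sequentially
proof (intro allI impI)
  fix x :: "nat \<Rightarrow> 's"
  assume x: "x \<longlonglongrightarrow> s0"
  have lx: "(\<lambda>k. l (x k)) \<longlonglongrightarrow> l s0" and rx: "(\<lambda>k. r (x k)) \<longlonglongrightarrow> r s0"
    using isCont_tendsto_compose[OF l x] isCont_tendsto_compose[OF r x] .
  have Nw: "N (w s) = r s" for s using max[of s] by (simp add: maximizes_iff)
  show "(w \<circ> x) \<longlonglongrightarrow> w s0"
  proof (rule bounded_seq_tendsto_unique_cluster_point)
    obtain \<delta> where \<delta>: "0 < \<delta>" "\<And>v. \<delta> * norm v \<le> N v" using dominates_norm by blast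
    obtain B where B: "\<And>k. norm (r (x k)) \<le> B"
      using convergent_imp_Bseq[OF convergentI[OF rx]] by (auto simp: Bseq_def)
    have "norm (w (x k)) \<le> B / \<delta>" for k
      using \<delta>(1) \<delta>(2)[of "w (x k)"] B[of k] by (simp add: Nw field_simps)
    then show "bounded (range (w \<circ> x))" by (intro boundedI[of _ "B / \<delta>"]) auto
  next
    fix \<rho> z
    assume \<rho>: "strict_mono \<rho>" and wz: "((w \<circ> x) \<circ> \<rho>) \<longlonglongrightarrow> z"
    let ?y = "\<lambda>k. x (\<rho> k)"
    have wy: "(\<lambda>k. w (?y k)) \<longlonglongrightarrow> z" using wz by (simp add: comp_def)
    have ly: "(\<lambda>k. l (?y k)) \<longlonglongrightarrow> l s0" and ry: "(\<lambda>k. r (?y k)) \<longlonglongrightarrow> r s0"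
      using LIMSEQ_subseq_LIMSEQ[OF lx \<rho>] LIMSEQ_subseq_LIMSEQ[OF rx \<rho>] by (simp_all add: comp_def)
    have Nz: "N z = r s0"
      using tendsto[OF wy] ry unfolding Nw by (rule LIMSEQ_unique)
    have "maximizes (l s0) (r s0) z"
      unfolding maximizes_iff
    proof (intro conjI allI impI)
      show "N z = r s0" by (fact Nz)
      fix v
      assume v: "N v = r s0"
      show "l s0 \<bullet> v \<le> l s0 \<bullet> z"
      proof (cases "r s0 = 0")
        case True
        then show ?thesis using v Nz by simp
      next
        case False
        then have r0: "0 < r s0" using nonneg[of v] v by linarith
        \<comment> \<open>the competitor \<open>v\<close>, rescaled to the sphere of radius \<open>r (?y k)\<close>\<close>
        let ?v = "\<lambda>k. (r (?y k) / r s0) *\<^sub>R v"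
        have "?v \<longlonglongrightarrow> (r s0 / r s0) *\<^sub>R v"
          using r0 by (intro tendsto_intros ry) auto
        then have vk: "?v \<longlonglongrightarrow> v" using r0 by simp
        have "N (?v k) = r (?y k)" for k
          using r0 nonneg[of "w (?y k)"] unfolding Nw by (simp add: scale v)
        then have "l (?y k) \<bullet> ?v k \<le> l (?y k) \<bullet> w (?y k)" for k
          using max[of "?y k"] unfolding maximizes_iff by blast
        then show ?thesis
          by (intro LIMSEQ_le[OF tendsto_inner[OF ly vk] tendsto_inner[OF ly wy]]) auto
      qed
    qed
    then show "z = w s0"
      using maximizes_unique[OF _ max ne] by blast
  qed
qed

end


section \<open>Stable laws and convergence in probability\<close>

text \<open>In this form the exponent is linear in \<open>\<sigma> powr \<alpha>\<close> and \<open>\<sigma> powr \<alpha> * \<beta>\<close>, which are therefore the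
  parameters that add up for sums of independent variables.\<close>

lemma stable_char_centred:
  "stable_char \<alpha> \<sigma> \<beta> 0 \<theta> = exp (- of_real (\<bar>\<theta>\<bar> powr \<alpha>)
     * (of_real (\<sigma> powr \<alpha>) - \<i> * of_real (\<sigma> powr \<alpha> * \<beta>) * of_real (sgn \<theta> * tan (pi * \<alpha> / 2))))"
  by (simp add: stable_char_def algebra_simps)

lemma norm_stable_char: "norm (stable_char \<alpha> \<sigma> \<beta> \<mu> \<theta>) = exp (- (\<sigma> powr \<alpha> * \<bar>\<theta>\<bar> powr \<alpha>))"
  by (simp add: stable_char_def norm_exp_eq_Re)

text \<open>The modulus of the characteristic function at \<open>1\<close> determines the scale.\<close>

lemma stable_scale_eq:
  assumes \<alpha>: "0 < \<alpha>" and law: "has_stable_law P Z \<alpha> \<sigma> \<beta> \<mu>"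
  shows "stable_scale P \<alpha> Z = \<sigma>"
  unfolding stable_scale_def
proof (rule the_equality)
  fix \<sigma>' assume "\<exists>\<beta> \<mu>. has_stable_law P Z \<alpha> \<sigma>' \<beta> \<mu>"
  then obtain \<beta>' \<mu>' where law': "has_stable_law P Z \<alpha> \<sigma>' \<beta>' \<mu>'" by blast
  have "norm (stable_char \<alpha> \<sigma> \<beta> \<mu> 1) = norm (stable_char \<alpha> \<sigma>' \<beta>' \<mu>' 1)"
    using law law' by (simp add: has_stable_law_def)
  then have "\<sigma>' powr \<alpha> = \<sigma> powr \<alpha>" by (simp add: norm_stable_char)
  then have "(\<sigma>' powr \<alpha>) powr (1 / \<alpha>) = (\<sigma> powr \<alpha>) powr (1 / \<alpha>)" by simp
  then show "\<sigma>' = \<sigma>" using law law' \<alpha> by (simp add: powr_powr has_stable_law_def)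
qed (use law in blast)

lemma char_distr_cmult:
  assumes [measurable]: "Z \<in> borel_measurable P"
  shows "char (distr P borel (\<lambda>\<omega>. c * Z \<omega>)) \<theta> = char (distr P borel Z) (c * \<theta>)"
  by (simp add: char_def integral_distr ac_simps)

lemma has_stable_law_cmult:
  assumes "has_stable_law P Z \<alpha> \<sigma> \<beta> 0"
  shows "has_stable_law P (\<lambda>\<omega>. c * Z \<omega>) \<alpha> (\<bar>c\<bar> * \<sigma>) (sgn c * \<beta>) 0"
proof -
  have *: "stable_char \<alpha> \<sigma> \<beta> 0 (c * \<theta>) = stable_char \<alpha> (\<bar>c\<bar> * \<sigma>) (sgn c * \<beta>) 0 \<theta>" for \<theta>
    using assms
    by (simp add: stable_char_def has_stable_law_def powr_mult abs_mult sgn_mult ac_simps)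
  show ?thesis
    using assms by (auto simp: has_stable_law_def char_distr_cmult * sgn_if)
qed

text \<open>The skewness of the sum is the average of the skewnesses, weighted by \<open>\<sigma> i powr \<alpha>\<close>. Being an
  average, it stays in \<open>{-1..1}\<close>.\<close>

lemma (in prob_space) has_stable_law_sum:
  assumes \<alpha>: "0 < \<alpha>" and fin: "finite I"
    and indep: "indep_vars (\<lambda>_. borel) Z I"
    and law: "\<And>i. i \<in> I \<Longrightarrow> has_stable_law M (Z i) \<alpha> (\<sigma> i) (\<beta> i) 0"
  shows "\<exists>\<beta>'. has_stable_law M (\<lambda>\<omega>. \<Sum>i\<in>I. Z i \<omega>) \<alpha> ((\<Sum>i\<in>I. \<sigma> i powr \<alpha>) powr (1 / \<alpha>)) \<beta>' 0"
proof -
  let ?S = "\<Sum>i\<in>I. \<sigma> i powr \<alpha>" and ?T = "\<Sum>i\<in>I. \<sigma> i powr \<alpha> * \<beta> i"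
  have S: "0 \<le> ?S" by (intro sum_nonneg) auto
  have "\<bar>?T\<bar> \<le> (\<Sum>i\<in>I. \<bar>\<sigma> i powr \<alpha> * \<beta> i\<bar>)" by (rule sum_abs)
  also have "\<dots> \<le> ?S"
  proof (rule sum_mono)
    fix i assume "i \<in> I"
    then have "\<bar>\<beta> i\<bar> \<le> 1" using law by (auto simp: has_stable_law_def abs_le_iff)
    then show "\<bar>\<sigma> i powr \<alpha> * \<beta> i\<bar> \<le> \<sigma> i powr \<alpha>"
      by (simp add: abs_mult mult_left_le)
  qed
  finally have TS: "\<bar>?T\<bar> \<le> ?S" .
  then have T: "?S * (?T / ?S) = ?T" by auto
  have range: "?T / ?S \<in> {-1..1}"
  proof (cases "?S = 0")
    case False
    then have "\<bar>?T / ?S\<bar> \<le> 1" using TS S by (simp add: abs_divide)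
    then show ?thesis using abs_le_D1[of "?T / ?S" 1] abs_le_D2[of "?T / ?S" 1] by force
  qed simp
  have "char (distr M borel (\<lambda>\<omega>. \<Sum>i\<in>I. Z i \<omega>)) \<theta>
      = stable_char \<alpha> (?S powr (1 / \<alpha>)) (?T / ?S) 0 \<theta>" for \<theta>
  proof -
    have "char (distr M borel (\<lambda>\<omega>. \<Sum>i\<in>I. Z i \<omega>)) \<theta> = (\<Prod>i\<in>I. stable_char \<alpha> (\<sigma> i) (\<beta> i) 0 \<theta>)"
      unfolding char_distr_sum[OF indep] using law by (intro prod.cong) (auto simp: has_stable_law_def)
    also have "\<dots> = exp (\<Sum>i\<in>I. - of_real (\<bar>\<theta>\<bar> powr \<alpha>) * (of_real (\<sigma> i powr \<alpha>)
        - \<i> * of_real (\<sigma> i powr \<alpha> * \<beta> i) * of_real (sgn \<theta> * tan (pi * \<alpha> / 2))))"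
      unfolding stable_char_centred by (rule exp_sum[OF fin, symmetric])
    also have "(\<Sum>i\<in>I. - of_real (\<bar>\<theta>\<bar> powr \<alpha>) * (of_real (\<sigma> i powr \<alpha>)
        - \<i> * of_real (\<sigma> i powr \<alpha> * \<beta> i) * of_real (sgn \<theta> * tan (pi * \<alpha> / 2))))
      = - of_real (\<bar>\<theta>\<bar> powr \<alpha>) * (of_real ?S
        - \<i> * of_real ?T * of_real (sgn \<theta> * tan (pi * \<alpha> / 2)))"
      by (simp only: sum_distrib_left[symmetric] sum_distrib_right[symmetric]
          sum_subtractf of_real_sum[symmetric])
    also have "exp \<dots> = stable_char \<alpha> (?S powr (1 / \<alpha>)) (?T / ?S) 0 \<theta>"
      unfolding stable_char_centred using \<alpha> S T by (simp add: powr_powr)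
    finally show ?thesis .
  qed
  moreover have "(\<lambda>\<omega>. \<Sum>i\<in>I. Z i \<omega>) \<in> borel_measurable M"
    using law by (intro borel_measurable_sum) (auto simp: has_stable_law_def)
  ultimately show ?thesis
    using range by (intro exI[of _ "?T / ?S"]) (auto simp: has_stable_law_def)
qed

lemma norm_iexp_diff_le: "norm (iexp x - iexp y) \<le> \<bar>x - y\<bar>"
proof -
  have "iexp x - iexp y = iexp y * (iexp (x - y) - 1)"
    by (simp add: algebra_simps flip: exp_add)
  also have "norm \<dots> = norm (iexp (x - y) - 1)"
    by (simp add: norm_mult)
  also have "\<dots> \<le> \<bar>x - y\<bar>"
    using iexp_approx1[of "x - y" 0] by simp
  finally show ?thesis .
qed

context prob_space
begin

text \<open>The integrands of the characteristic functions differ by at most \<open>\<bar>\<theta>\<bar> * \<epsilon>\<close> where the variables are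
  \<open>\<epsilon>\<close>-close, and by at most \<open>2\<close> on the rest, whose probability tends to \<open>0\<close>.\<close>

lemma tendsto_in_probability_char:
  assumes [measurable]: "\<And>k. Y k \<in> borel_measurable M" "Z \<in> borel_measurable M"
    and lim: "tendsto_in_probability M Y Z"
  shows "(\<lambda>k. char (distr M borel (Y k)) \<theta>) \<longlonglongrightarrow> char (distr M borel Z) \<theta>"
proof (rule tendstoI)
  fix e :: real
  assume e: "0 < e"
  \<comment> \<open>\<open>\<bar>\<theta>\<bar> * \<epsilon>\<close> stays below \<open>e / 2\<close>; adding \<open>1\<close> covers \<open>\<theta> = 0\<close>\<close>
  define \<epsilon> where "\<epsilon> = e / (2 * (\<bar>\<theta>\<bar> + 1))"
  have \<epsilon>: "0 < \<epsilon>" "\<bar>\<theta>\<bar> * \<epsilon> < e / 2"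
    using e by (auto simp: \<epsilon>_def divide_simps)
  let ?A = "\<lambda>k. {\<omega> \<in> space M. \<epsilon> < \<bar>Y k \<omega> - Z \<omega>\<bar>}"
  have bound: "norm (char (distr M borel (Y k)) \<theta> - char (distr M borel Z) \<theta>)
      \<le> \<bar>\<theta>\<bar> * \<epsilon> + 2 * prob (?A k)" for k
  proof -
    have int: "complex_integrable M (\<lambda>\<omega>. iexp (\<theta> * W \<omega>))" if [measurable]: "W \<in> borel_measurable M" for W
      by (rule integrable_iexp) auto
    have "char (distr M borel (Y k)) \<theta> - char (distr M borel Z) \<theta>
        = (CLINT \<omega>|M. iexp (\<theta> * Y k \<omega>) - iexp (\<theta> * Z \<omega>))"
      using int by (simp add: char_def integral_distr)
    also have "norm \<dots> \<le> (LINT \<omega>|M. norm (iexp (\<theta> * Y k \<omega>) - iexp (\<theta> * Z \<omega>)))"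
      by (rule integral_norm_bound)
    also have "\<dots> \<le> (LINT \<omega>|M. \<bar>\<theta>\<bar> * \<epsilon> + 2 * indicator (?A k) \<omega>)"
    proof (rule integral_mono)
      show "integrable M (\<lambda>\<omega>. norm (iexp (\<theta> * Y k \<omega>) - iexp (\<theta> * Z \<omega>)))"
        using int by (intro integrable_norm Bochner_Integration.integrable_diff) auto
      show "integrable M (\<lambda>\<omega>. \<bar>\<theta>\<bar> * \<epsilon> + 2 * indicator (?A k) \<omega>)"
        by (intro Bochner_Integration.integrable_add integrable_const integrable_mult_right
            integrable_real_indicator) (auto simp: emeasure_eq_measure)
      fix \<omega> assume "\<omega> \<in> space M"
      show "norm (iexp (\<theta> * Y k \<omega>) - iexp (\<theta> * Z \<omega>)) \<le> \<bar>\<theta>\<bar> * \<epsilon> + 2 * indicator (?A k) \<omega>"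
      proof (cases "\<omega> \<in> ?A k")
        case True
        have "norm (iexp (\<theta> * Y k \<omega>) - iexp (\<theta> * Z \<omega>))
            \<le> norm (iexp (\<theta> * Y k \<omega>)) + norm (iexp (\<theta> * Z \<omega>))"
          by (rule norm_triangle_ineq4)
        also have "\<dots> = 2" by simp
        finally have "norm (iexp (\<theta> * Y k \<omega>) - iexp (\<theta> * Z \<omega>)) \<le> 2" .
        moreover have "0 \<le> \<bar>\<theta>\<bar> * \<epsilon>" using \<epsilon>(1) by simp
        ultimately show ?thesis
          unfolding indicator_simps(1)[OF True] by linarith
      next
        case False
        have "norm (iexp (\<theta> * Y k \<omega>) - iexp (\<theta> * Z \<omega>)) \<le> \<bar>\<theta> * Y k \<omega> - \<theta> * Z \<omega>\<bar>"
          by (rule norm_iexp_diff_le)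
        also have "\<dots> = \<bar>\<theta>\<bar> * \<bar>Y k \<omega> - Z \<omega>\<bar>"
          by (simp add: right_diff_distrib[symmetric] abs_mult)
        also have "\<dots> \<le> \<bar>\<theta>\<bar> * \<epsilon>"
          using False \<open>\<omega> \<in> space M\<close> by (intro mult_left_mono) auto
        finally show ?thesis
          unfolding indicator_simps(2)[OF False] by linarith
      qed
    qed
    also have "\<dots> = \<bar>\<theta>\<bar> * \<epsilon> + 2 * prob (?A k)"
    proof -
      have "integrable M (indicator (?A k) :: _ \<Rightarrow> real)"
        by (intro integrable_real_indicator) (auto simp: emeasure_eq_measure)
      then show ?thesis by (simp add: prob_space measure_def[symmetric])
    qed
    finally show ?thesis .
  qed
  have "(\<lambda>k. prob (?A k)) \<longlonglongrightarrow> 0"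
    using lim \<epsilon>(1) by (simp add: tendsto_in_probability_def)
  then have "eventually (\<lambda>k. prob (?A k) < e / 4) sequentially"
    by (rule order_tendstoD) (use e in simp)
  then show "eventually (\<lambda>k. dist (char (distr M borel (Y k)) \<theta>) (char (distr M borel Z) \<theta>) < e)
      sequentially"
  proof eventually_elim
    case (elim k)
    then show ?case
      using bound[of k] \<epsilon>(2) unfolding dist_norm by linarith
  qed
qed

text \<open>The skewnesses lie in a compact interval, so a subsequence of them converges, and the limit law is
  read off along that subsequence. Thus only the scales have to be shown to converge.\<close>

lemma has_stable_law_limit:
  assumes meas: "Z \<in> borel_measurable M"
    and law: "\<And>k. \<exists>\<beta>. has_stable_law M (Y k) \<alpha> (\<sigma> k) \<beta> 0"
    and \<sigma>: "\<sigma> \<longlonglongrightarrow> s" and lim: "tendsto_in_probability M Y Z" and \<alpha>: "0 < \<alpha>"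
  shows "\<exists>\<beta>. has_stable_law M Z \<alpha> s \<beta> 0"
proof -
  obtain \<beta> where \<beta>: "\<And>k. has_stable_law M (Y k) \<alpha> (\<sigma> k) (\<beta> k) 0"
    using law by metis
  then have "\<And>k. \<beta> k \<in> {-1..1}" by (simp add: has_stable_law_def)
  then obtain b \<rho> where b: "b \<in> {-1..1}" "strict_mono \<rho>" "(\<beta> \<circ> \<rho>) \<longlonglongrightarrow> b"
    using compact_imp_seq_compact[OF compact_Icc, of "-1" "1::real"] unfolding seq_compact_def by blast
  have \<sigma>_nonneg: "0 \<le> \<sigma> k" for k using \<beta>[of k] by (simp add: has_stable_law_def)
  have "char (distr M borel Z) \<theta> = stable_char \<alpha> s b 0 \<theta>" for \<theta>
  proof -
    have "(\<lambda>k. stable_char \<alpha> (\<sigma> (\<rho> k)) (\<beta> (\<rho> k)) 0 \<theta>) \<longlonglongrightarrow> stable_char \<alpha> s b 0 \<theta>"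
      unfolding stable_char_def
      using LIMSEQ_subseq_LIMSEQ[OF \<sigma> b(2)] b(3) \<alpha> \<sigma>_nonneg
      by (intro tendsto_intros tendsto_powr') (auto simp: comp_def)
    moreover have "(\<lambda>k. char (distr M borel (Y k)) \<theta>) \<longlonglongrightarrow> char (distr M borel Z) \<theta>"
      using \<beta> by (intro tendsto_in_probability_char meas lim) (auto simp: has_stable_law_def)
    then have "(\<lambda>k. stable_char \<alpha> (\<sigma> (\<rho> k)) (\<beta> (\<rho> k)) 0 \<theta>) \<longlonglongrightarrow> char (distr M borel Z) \<theta>"
      using LIMSEQ_subseq_LIMSEQ[OF _ b(2)] \<beta> by (simp add: has_stable_law_def comp_def)
    ultimately show ?thesis by (rule LIMSEQ_unique[rotated])
  qed
  moreover have "0 \<le> s" by (rule LIMSEQ_le_const[OF \<sigma>]) (use \<sigma>_nonneg in auto)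
  ultimately show ?thesis using b(1) meas by (auto simp: has_stable_law_def)
qed

lemma tendsto_in_probability_cong_AE:
  assumes [measurable]: "\<And>k. Y k \<in> borel_measurable M" "\<And>k. Y' k \<in> borel_measurable M"
      "Z \<in> borel_measurable M"
    and eq: "\<And>k. AE \<omega> in M. Y k \<omega> = Y' k \<omega>" and lim: "tendsto_in_probability M Y Z"
  shows "tendsto_in_probability M Y' Z"
proof -
  have "prob {\<omega> \<in> space M. \<epsilon> < \<bar>Y' k \<omega> - Z \<omega>\<bar>} = prob {\<omega> \<in> space M. \<epsilon> < \<bar>Y k \<omega> - Z \<omega>\<bar>}" for \<epsilon> k
  proof (rule finite_measure_eq_AE)
    show "AE \<omega> in M. (\<omega> \<in> {\<omega> \<in> space M. \<epsilon> < \<bar>Y' k \<omega> - Z \<omega>\<bar>})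
        = (\<omega> \<in> {\<omega> \<in> space M. \<epsilon> < \<bar>Y k \<omega> - Z \<omega>\<bar>})"
      using eq[of k] by eventually_elim simp
  qed measurable
  then show ?thesis using lim by (simp add: tendsto_in_probability_def)
qed

lemma tendsto_in_probability_cmult:
  assumes "tendsto_in_probability M Y Z"
  shows "tendsto_in_probability M (\<lambda>k \<omega>. c * Y k \<omega>) (\<lambda>\<omega>. c * Z \<omega>)"
proof (cases "c = 0")
  case False
  have "(\<epsilon> < \<bar>c * x - c * y\<bar>) = (\<epsilon> / \<bar>c\<bar> < \<bar>x - y\<bar>)" for x y \<epsilon> :: real
    using False by (simp add: right_diff_distrib[symmetric] abs_mult pos_divide_less_eq mult.commute)
  then show ?thesis
    using assms False by (simp add: tendsto_in_probability_def)
qed (simp add: tendsto_in_probability_def)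

lemma tendsto_in_probability_add:
  assumes [measurable]: "\<And>k. Y k \<in> borel_measurable M" "\<And>k. Y' k \<in> borel_measurable M"
      "Z \<in> borel_measurable M" "Z' \<in> borel_measurable M"
    and lim: "tendsto_in_probability M Y Z" "tendsto_in_probability M Y' Z'"
  shows "tendsto_in_probability M (\<lambda>k \<omega>. Y k \<omega> + Y' k \<omega>) (\<lambda>\<omega>. Z \<omega> + Z' \<omega>)"
  unfolding tendsto_in_probability_def
proof (intro allI impI)
  fix \<epsilon> :: real
  assume \<epsilon>: "0 < \<epsilon>"
  let ?A = "\<lambda>k. {\<omega> \<in> space M. \<epsilon> / 2 < \<bar>Y k \<omega> - Z \<omega>\<bar>}"
    and ?B = "\<lambda>k. {\<omega> \<in> space M. \<epsilon> / 2 < \<bar>Y' k \<omega> - Z' \<omega>\<bar>}"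
    and ?C = "\<lambda>k. {\<omega> \<in> space M. \<epsilon> < \<bar>(Y k \<omega> + Y' k \<omega>) - (Z \<omega> + Z' \<omega>)\<bar>}"
  have bound: "prob (?C k) \<le> prob (?A k) + prob (?B k)" for k
  proof -
    have sets: "?A k \<in> events" "?B k \<in> events" by measurable
    have "\<epsilon> / 2 < \<bar>a - c\<bar> \<or> \<epsilon> / 2 < \<bar>b - d\<bar>" if "\<epsilon> < \<bar>(a + b) - (c + d)\<bar>" for a b c d :: real
      using that by arith
    then have "?C k \<subseteq> ?A k \<union> ?B k" by blast
    then have "prob (?C k) \<le> prob (?A k \<union> ?B k)"
      using sets by (intro finite_measure_mono sets.Un)
    also have "\<dots> \<le> prob (?A k) + prob (?B k)"
      using sets
      by (rule measure_subadditive)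
         (simp_all only: infinity_ennreal_def emeasure_finite not_False_eq_True)
    finally show ?thesis .
  qed
  have "(\<lambda>k. prob (?A k) + prob (?B k)) \<longlonglongrightarrow> 0 + 0"
    by (intro tendsto_add lim[unfolded tendsto_in_probability_def, rule_format] half_gt_zero \<epsilon>)
  then have lim0: "(\<lambda>k. prob (?A k) + prob (?B k)) \<longlonglongrightarrow> 0" by simp
  show "(\<lambda>k. prob (?C k)) \<longlonglongrightarrow> 0"
    by (intro Lim_null_comparison[OF _ lim0] always_eventually allI)
       (simp only: real_norm_def abs_of_nonneg measure_nonneg bound)
qed

text \<open>The characteristic function is constantly \<open>1\<close>, which by Levy's uniqueness theorem is that of the point mass
  at \<open>0\<close>.\<close>

lemma has_stable_law_scale_0:
  assumes "has_stable_law M Z \<alpha> 0 \<beta> 0"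
  shows "AE \<omega> in M. Z \<omega> = 0"
proof -
  have [measurable]: "Z \<in> borel_measurable M" using assms by (simp add: has_stable_law_def)
  interpret Z: real_distribution "distr M borel Z" by (rule real_distribution_distr) simp
  interpret R: prob_space "return borel (0::real)" by (rule prob_space_return) simp
  have "distr M borel Z = return borel 0"
  proof (rule Levy_uniqueness)
    show "real_distribution (return borel (0::real))" by unfold_locales simp
    show "char (distr M borel Z) = char (return borel 0)"
    proof
      fix \<theta>
      have "char (return borel 0) \<theta> = iexp (\<theta> * 0)"
        unfolding char_def by (rule integral_return) auto
      then show "char (distr M borel Z) \<theta> = char (return borel 0) \<theta>"
        using assms by (simp add: has_stable_law_def stable_char_def)
    qed
  qed unfold_locales
  moreover have "AE x in return borel (0::real). x = 0" by (simp add: AE_return)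
  ultimately have "AE x in distr M borel Z. x = 0" by (simp only:)
  then show ?thesis by (subst (asm) AE_distr_iff) auto
qed

lemma has_stable_law_scale_0_const: "has_stable_law M (\<lambda>_. 0) \<alpha> 0 0 0"
  by (simp add: has_stable_law_def stable_char_def char_def integral_distr prob_space
      del: distr_const)

text \<open>For \<open>\<alpha> = 2\<close> the skewness term disappears, as \<open>tan \<pi> = 0\<close>, and the law is normal with
  variance \<open>2 * \<sigma>\<^sup>2\<close>, a point mass if \<open>\<sigma> = 0\<close>.\<close>

lemma gaussian_square_integrable:
  assumes law: "has_stable_law M Z 2 \<sigma> \<beta> 0"
  shows "integrable M (\<lambda>\<omega>. (Z \<omega>)\<^sup>2)"
proof (cases "\<sigma> = 0")
  case True
  have [measurable]: "Z \<in> borel_measurable M" using law by (simp add: has_stable_law_def)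
  have "AE \<omega> in M. (Z \<omega>)\<^sup>2 = 0"
    using has_stable_law_scale_0[of Z 2 \<beta>] law True by auto
  then show ?thesis
    by (subst integrable_cong_AE[of _ _ "\<lambda>_. 0"]) auto
next
  case False
  have [measurable]: "Z \<in> borel_measurable M" using law by (simp add: has_stable_law_def)
  have \<sigma>: "0 < \<sigma>" using False law by (simp add: has_stable_law_def)
  let ?c = "1 / (sqrt 2 * \<sigma>)"
  let ?W = "\<lambda>\<omega>. ?c * Z \<omega>"
  have "distr M borel ?W = std_normal_distribution"
  proof (rule Levy_uniqueness)
    show "real_distribution (distr M borel ?W)" by (rule real_distribution_distr) simp
    show "real_distribution std_normal_distribution" by (rule real_dist_normal_dist)
    have "char (distr M borel ?W) \<theta> = of_real (exp (- \<theta>\<^sup>2 / 2))" for \<theta>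
    proof -
      have "\<sigma> powr 2 * \<bar>?c * \<theta>\<bar> powr 2 = \<theta>\<^sup>2 / 2"
        using \<sigma> by (simp add: powr_numeral power_mult_distrib power_divide)
      moreover have "stable_char 2 \<sigma> \<beta> 0 x = exp (- of_real (\<sigma> powr 2 * \<bar>x\<bar> powr 2))" for x
        unfolding stable_char_def by simp
      ultimately have "stable_char 2 \<sigma> \<beta> 0 (?c * \<theta>) = exp (- of_real (\<theta>\<^sup>2 / 2))"
        by (simp only:)
      then show ?thesis
        using law unfolding char_distr_cmult[OF \<open>Z \<in> borel_measurable M\<close>] has_stable_law_def
        by (simp flip: exp_of_real)
    qed
    then show "char (distr M borel ?W) = char std_normal_distribution"
      unfolding char_std_normal_distribution by (intro ext)
  qed
  then have "integrable (distr M borel ?W) (\<lambda>x. x\<^sup>2)"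
    using integrable_std_normal_distribution_moment[of 2] by simp
  then have "integrable M (\<lambda>\<omega>. (?W \<omega>)\<^sup>2)"
    by (subst (asm) integrable_distr_eq) auto
  then have "integrable M (\<lambda>\<omega>. (sqrt 2 * \<sigma>)\<^sup>2 * (?W \<omega>)\<^sup>2)" by (rule integrable_mult_right)
  moreover have "(sqrt 2 * \<sigma>)\<^sup>2 * (?W \<omega>)\<^sup>2 = (Z \<omega>)\<^sup>2" for \<omega>
    using \<sigma> by (simp flip: power_mult_distrib)
  ultimately show ?thesis by (simp only:)
qed

end


section \<open>Integrals with respect to a stable random measure\<close>

lemma simple_bochner_integrable_imp_Lalpha:
  assumes s: "Bochner_Integration.simple_bochner_integrable m s"
  shows "s \<in> Lalpha m \<alpha>"
  unfolding Lalpha_iff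
proof
  show "s \<in> borel_measurable m"
    using s by (auto elim: Bochner_Integration.simple_bochner_integrable.cases
        intro: borel_measurable_simple_function)
  have "Bochner_Integration.simple_bochner_integrable m (\<lambda>x. \<bar>s x\<bar> powr \<alpha>)"
    using simple_bochner_integrable_compose2[of "\<lambda>a _. \<bar>a\<bar> powr \<alpha>", OF _ s s] by simp
  then show "integrable m (\<lambda>x. \<bar>s x\<bar> powr \<alpha>)"
    using has_bochner_integral_simple_bochner_integrable by (auto simp: integrable.simps)
qed

text \<open>This translates the approximation of integrands into convergence in the norm.\<close>

lemma Lalpha_converges_iff:
  assumes \<alpha>: "1 < \<alpha>" and u: "\<And>k. u k \<in> Lalpha m \<alpha>"
  shows "((\<lambda>k. \<integral>\<^sup>+ x. ennreal (\<bar>u k x\<bar> powr \<alpha>) \<partial>m) \<longlonglongrightarrow> 0) \<longleftrightarrow> (\<lambda>k. Lnorm m \<alpha> (u k)) \<longlonglongrightarrow> 0"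
proof -
  have eq: "(\<integral>\<^sup>+ x. ennreal (\<bar>u k x\<bar> powr \<alpha>) \<partial>m) = ennreal (Lnorm m \<alpha> (u k) powr \<alpha>)" for k
    using nn_integral_eq_integral[OF Lalpha_integrable[OF u]] by (simp add: Lnorm_powr[OF \<alpha>])
  have "((\<lambda>k. ennreal (Lnorm m \<alpha> (u k) powr \<alpha>)) \<longlonglongrightarrow> ennreal 0)
      \<longleftrightarrow> (\<lambda>k. Lnorm m \<alpha> (u k) powr \<alpha>) \<longlonglongrightarrow> 0"
    by (rule tendsto_ennreal_iff) auto
  also have "\<dots> \<longleftrightarrow> (\<lambda>k. Lnorm m \<alpha> (u k)) \<longlonglongrightarrow> 0"
  proof
    assume "(\<lambda>k. Lnorm m \<alpha> (u k) powr \<alpha>) \<longlonglongrightarrow> 0"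
    then have "(\<lambda>k. (Lnorm m \<alpha> (u k) powr \<alpha>) powr (1 / \<alpha>)) \<longlonglongrightarrow> 0 powr (1 / \<alpha>)"
      using \<alpha> by (intro tendsto_powr') auto
    then show "(\<lambda>k. Lnorm m \<alpha> (u k)) \<longlonglongrightarrow> 0" using \<alpha> by (simp add: powr_powr)
  next
    assume "(\<lambda>k. Lnorm m \<alpha> (u k)) \<longlonglongrightarrow> 0"
    then have "(\<lambda>k. Lnorm m \<alpha> (u k) powr \<alpha>) \<longlonglongrightarrow> 0 powr \<alpha>"
      using \<alpha> by (intro tendsto_powr') auto
    then show "(\<lambda>k. Lnorm m \<alpha> (u k) powr \<alpha>) \<longlonglongrightarrow> 0" by simp
  qed
  finally show ?thesis by (simp add: eq)
qed

lemma level_set_in_finite_sets: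
  assumes p: "Bochner_Integration.simple_bochner_integrable m p" and v: "v \<noteq> 0"
  shows "{x \<in> space m. p x = v} \<in> finite_sets m"
proof -
  have sf: "simple_function m p" and fin: "emeasure m {x \<in> space m. p x \<noteq> 0} \<noteq> \<infinity>"
    using p by (auto elim: Bochner_Integration.simple_bochner_integrable.cases)
  have meas: "{x \<in> space m. Q (p x)} \<in> sets m" for Q
    using simple_functionD(2)[OF sf, of "Collect Q"] by (auto simp: vimage_def Int_def conj_commute)
  have "emeasure m {x \<in> space m. p x = v} \<le> emeasure m {x \<in> space m. p x \<noteq> 0}"
    using v by (intro emeasure_mono meas) auto
  then show ?thesis
    using fin meas by (auto simp: finite_sets_def less_top[symmetric] top_unique)
qed

context stable_random_measure
begin

lemma index_pos: "0 < \<alpha>"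
  using index_gt_1 by simp

lemma random_measure_measurable: "A \<in> finite_sets m \<Longrightarrow> M A \<in> borel_measurable P"
  using stable_law by (auto simp: has_stable_law_def)

lemma empty_finite_set: "{} \<in> finite_sets m"
  by (simp add: finite_sets_def)

lemma random_measure_empty: "AE \<omega> in P. M {} \<omega> = 0"
  using stable_law[OF empty_finite_set] has_stable_law_scale_0 by simp

text \<open>A finite family is extended by empty sets to a sequence, on which \<open>\<sigma>\<close>-additivity applies.\<close>

lemma random_measure_finite_Union:
  assumes fin: "finite I" and A: "\<And>i. i \<in> I \<Longrightarrow> A i \<in> finite_sets m"
    and disj: "disjoint_family_on A I"
  shows "AE \<omega> in P. M (\<Union>i\<in>I. A i) \<omega> = (\<Sum>i\<in>I. M (A i) \<omega>)"
proof -
  obtain e where e: "bij_betw e {0..<card I} I" using ex_bij_betw_nat_finite[OF fin] by blast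
  let ?B = "\<lambda>k. if k < card I then A (e k) else {}"
  have eI: "e k \<in> I" if "k < card I" for k using e that by (auto simp: bij_betw_def)
  have B: "range ?B \<subseteq> finite_sets m" using eI A empty_finite_set by auto
  have eimg: "e ` {0..<card I} = I" using e by (simp add: bij_betw_def)
  have "A (e i) \<inter> A (e j) = {}" if "i < card I" "j < card I" "i \<noteq> j" for i j
    using that eI e by (intro disjoint_family_onD[OF disj]) (auto simp: bij_betw_def inj_on_def)
  then have "disjoint_family ?B" by (auto simp: disjoint_family_on_def)
  moreover have U: "(\<Union>k. ?B k) = (\<Union>i\<in>I. A i)"
  proof -
    have "(\<Union>k. ?B k) = (\<Union>i\<in>e ` {0..<card I}. A i)" by (auto split: if_splits)
    then show ?thesis unfolding eimg .
  qed
  moreover have "(\<Union>i\<in>I. A i) \<in> finite_sets m"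
  proof -
    have "emeasure m (\<Union>i\<in>I. A i) \<le> (\<Sum>i\<in>I. emeasure m (A i))"
      using A fin by (intro emeasure_subadditive_finite) (auto simp: finite_sets_def)
    also have "\<dots> < \<infinity>" using A fin by (auto simp: finite_sets_def)
    finally show ?thesis using A fin by (auto simp: finite_sets_def)
  qed
  ultimately have "AE \<omega> in P. (\<lambda>k. M (?B k) \<omega>) sums M (\<Union>i\<in>I. A i) \<omega>"
    using sigma_additive[OF B] by simp
  with random_measure_empty show ?thesis
  proof eventually_elim
    case (elim \<omega>)
    have "(\<lambda>k. M (?B k) \<omega>) sums (\<Sum>k\<in>{0..<card I}. M (?B k) \<omega>)"
      using elim by (intro sums_finite) auto
    also have "(\<Sum>k\<in>{0..<card I}. M (?B k) \<omega>) = (\<Sum>k\<in>{0..<card I}. M (A (e k)) \<omega>)"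
      by (intro sum.cong) auto
    also have "\<dots> = (\<Sum>i\<in>I. M (A i) \<omega>)" by (rule sum.reindex_bij_betw[OF e])
    finally show ?case using elim sums_unique2 by blast
  qed
qed

lemma simple_stable_integral_measurable:
  assumes s: "Bochner_Integration.simple_bochner_integrable m s"
  shows "simple_stable_integral m M s \<in> borel_measurable P"
  unfolding simple_stable_integral_def
  by (intro borel_measurable_sum borel_measurable_times borel_measurable_const
      random_measure_measurable level_set_in_finite_sets[OF s]) auto

text \<open>The integral is a sum of independent multiples of the random measures of the level sets.\<close>

lemma simple_stable_integral_law:
  assumes s: "Bochner_Integration.simple_bochner_integrable m s"
  shows "\<exists>\<beta>'. has_stable_law P (simple_stable_integral m M s) \<alpha> (Lnorm m \<alpha> s) \<beta>' 0"
proof -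
  let ?I = "s ` space m - {0}"
  let ?A = "\<lambda>c. {x \<in> space m. s x = c}"
  have fin: "finite ?I"
    using s by (auto elim: Bochner_Integration.simple_bochner_integrable.cases dest: simple_functionD)
  have A: "?A c \<in> finite_sets m" if "c \<noteq> 0" for c
    using level_set_in_finite_sets[OF s that] .
  obtain e where e: "bij_betw e {0..<card ?I} ?I" using ex_bij_betw_nat_finite[OF fin] by blast
  have eI: "e k \<in> ?I" if "k \<in> {0..<card ?I}" for k using e that by (auto simp: bij_betw_def)
  \<comment> \<open>independence is available for sequences of sets, hence the enumeration of the values\<close>
  let ?B = "\<lambda>k. if k < card ?I then ?A (e k) else {}"
  have B: "range ?B \<subseteq> finite_sets m"
    using eI A empty_finite_set by auto
  have "disjoint_family ?B"
    using e by (auto simp: disjoint_family_on_def bij_betw_def inj_on_def)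
  then have "indep_vars (\<lambda>_. borel) (\<lambda>k. M (?B k)) UNIV"
    by (rule independently_scattered[OF B])
  then have indep: "indep_vars (\<lambda>_. borel) (\<lambda>k. M (?B k)) {0..<card ?I}"
    by (rule indep_vars_subset) auto
  have indep': "indep_vars (\<lambda>_. borel) (\<lambda>k \<omega>. e k * M (?B k) \<omega>) {0..<card ?I}"
    by (rule indep_vars_compose2[OF indep]) measurable
  let ?\<sigma> = "\<lambda>k. \<bar>e k\<bar> * measure m (?B k) powr (1 / \<alpha>)"
  have law: "has_stable_law P (\<lambda>\<omega>. e k * M (?B k) \<omega>) \<alpha> (?\<sigma> k)
      (sgn (e k) * ((LINT x:(?B k)|m. \<beta> x) / measure m (?B k))) 0" for k
    using B by (intro has_stable_law_cmult stable_law) auto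
  have reindex: "(\<Sum>k\<in>{0..<card ?I}. h (e k) (?B k)) = (\<Sum>c\<in>?I. h c (?A c))"
    for h :: "real \<Rightarrow> 'e set \<Rightarrow> real"
    using sum.reindex_bij_betw[OF e, of "\<lambda>c. h c (?A c)"] by simp
  have "(\<Sum>k\<in>{0..<card ?I}. ?\<sigma> k powr \<alpha>) = (\<Sum>k\<in>{0..<card ?I}. \<bar>e k\<bar> powr \<alpha> * measure m (?B k))"
    using index_pos by (intro sum.cong refl) (simp add: powr_mult powr_powr)
  also have "\<dots> = (\<Sum>c\<in>?I. \<bar>c\<bar> powr \<alpha> * measure m (?A c))"
    by (rule reindex)
  also have "\<dots> = (\<Sum>c\<in>?I. (LINT x|m. \<bar>c\<bar> powr \<alpha> * indicator (?A c) x))"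
    using A by (intro sum.cong refl) (simp add: finite_sets_def)
  also have "\<dots> = (LINT x|m. (\<Sum>c\<in>?I. \<bar>c\<bar> powr \<alpha> * indicator (?A c) x))"
    using A by (intro Bochner_Integration.integral_sum[symmetric] integrable_mult_right
        integrable_real_indicator) (auto simp: finite_sets_def)
  also have "\<dots> = (LINT x|m. \<bar>s x\<bar> powr \<alpha>)"
  proof (rule Bochner_Integration.integral_cong[OF refl])
    fix x assume x: "x \<in> space m"
    have "(\<Sum>c\<in>?I. \<bar>c\<bar> powr \<alpha> * indicator (?A c) x) = (\<Sum>c\<in>?I. if c = s x then \<bar>s x\<bar> powr \<alpha> else 0)"
      using x by (intro sum.cong) (auto simp: indicator_def)
    also have "\<dots> = \<bar>s x\<bar> powr \<alpha>"
      using x fin by (cases "s x = 0") (auto simp: sum.delta)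
    finally show "(\<Sum>c\<in>?I. \<bar>c\<bar> powr \<alpha> * indicator (?A c) x) = \<bar>s x\<bar> powr \<alpha>" .
  qed
  finally have scale: "(\<Sum>k\<in>{0..<card ?I}. ?\<sigma> k powr \<alpha>) powr (1 / \<alpha>) = Lnorm m \<alpha> s"
    by (simp add: Lnorm_def)
  have "(\<lambda>\<omega>. \<Sum>k\<in>{0..<card ?I}. e k * M (?B k) \<omega>) = simple_stable_integral m M s"
    unfolding simple_stable_integral_def by (intro ext reindex)
  then show ?thesis
    using has_stable_law_sum[OF index_pos _ indep' law] unfolding scale by auto
qed

text \<open>The key to linearity: the integral of a function of \<open>p\<close> can be computed on the level sets of \<open>p\<close>,
  which may be a finer partition than the level sets of the integrand. Applied to \<open>p = (s, s')\<close>, it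
  expresses the integrals of \<open>s\<close>, \<open>s'\<close> and their linear combinations over one common partition. As \<open>M\<close> is
  additive only almost surely, so is this identity.\<close>

lemma simple_stable_integral_image:
  fixes p :: "'e \<Rightarrow> 'v::real_vector" and \<phi> :: "'v \<Rightarrow> real"
  assumes p: "Bochner_Integration.simple_bochner_integrable m p" and \<phi>: "\<phi> 0 = 0"
  shows "AE \<omega> in P. simple_stable_integral m M (\<lambda>x. \<phi> (p x)) \<omega>
    = (\<Sum>v\<in>p ` space m - {0}. \<phi> v * M {x \<in> space m. p x = v} \<omega>)"
proof -
  let ?V = "p ` space m - {0}" and ?C = "(\<lambda>x. \<phi> (p x)) ` space m - {0}"
  let ?A = "\<lambda>v. {x \<in> space m. p x = v}"
  have finV: "finite ?V"
    using p by (auto elim: Bochner_Integration.simple_bochner_integrable.cases dest: simple_functionD)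
  have finC: "finite ?C"
    by (rule finite_subset[OF _ finite_imageI[OF finV, of \<phi>]]) (auto simp: \<phi>)
  have level: "{x \<in> space m. \<phi> (p x) = c} = (\<Union>v\<in>{v \<in> ?V. \<phi> v = c}. ?A v)" if "c \<noteq> 0" for c
    using that \<phi> by auto
  have "AE \<omega> in P. \<forall>c\<in>?C. M {x \<in> space m. \<phi> (p x) = c} \<omega> = (\<Sum>v\<in>{v \<in> ?V. \<phi> v = c}. M (?A v) \<omega>)"
  proof (rule AE_finite_allI[OF finC])
    fix c assume "c \<in> ?C"
    then have "c \<noteq> 0" by simp
    show "AE \<omega> in P. M {x \<in> space m. \<phi> (p x) = c} \<omega> = (\<Sum>v\<in>{v \<in> ?V. \<phi> v = c}. M (?A v) \<omega>)"
      unfolding level[OF \<open>c \<noteq> 0\<close>]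
      by (rule random_measure_finite_Union)
         (use finV level_set_in_finite_sets[OF p] in \<open>auto simp: disjoint_family_on_def\<close>)
  qed
  then show ?thesis
  proof eventually_elim
    case (elim \<omega>)
    let ?S = "{v \<in> ?V. \<phi> v \<noteq> 0}"
    have "simple_stable_integral m M (\<lambda>x. \<phi> (p x)) \<omega>
        = (\<Sum>c\<in>?C. \<Sum>v\<in>{v \<in> ?S. \<phi> v = c}. \<phi> v * M (?A v) \<omega>)"
      unfolding simple_stable_integral_def
    proof (rule sum.cong[OF refl])
      fix c assume c: "c \<in> ?C"
      then have "{v \<in> ?S. \<phi> v = c} = {v \<in> ?V. \<phi> v = c}" by auto
      then show "c * M {x \<in> space m. \<phi> (p x) = c} \<omega> = (\<Sum>v\<in>{v \<in> ?S. \<phi> v = c}. \<phi> v * M (?A v) \<omega>)"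
        using elim c by (simp add: sum_distrib_left)
    qed
    also have "\<dots> = (\<Sum>v\<in>?S. \<phi> v * M (?A v) \<omega>)"
      using finV finC by (intro sum.group) auto
    also have "\<dots> = (\<Sum>v\<in>?V. \<phi> v * M (?A v) \<omega>)"
      using finV by (intro sum.mono_neutral_left) auto
    finally show ?case .
  qed
qed

lemma simple_stable_integral_lincomb:
  assumes s: "Bochner_Integration.simple_bochner_integrable m s"
    and s': "Bochner_Integration.simple_bochner_integrable m s'"
  shows "AE \<omega> in P. a * simple_stable_integral m M s \<omega> + b * simple_stable_integral m M s' \<omega>
    = simple_stable_integral m M (\<lambda>x. a * s x + b * s' x) \<omega>"
proof -
  have p: "Bochner_Integration.simple_bochner_integrable m (\<lambda>x. (s x, s' x))"
    by (rule simple_bochner_integrable_compose2[OF _ s s']) (simp add: zero_prod_def)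
  note image = simple_stable_integral_image[OF p]
  have fst: "AE \<omega> in P. simple_stable_integral m M s \<omega>
      = (\<Sum>v\<in>(\<lambda>x. (s x, s' x)) ` space m - {0}. fst v * M {x \<in> space m. (s x, s' x) = v} \<omega>)"
    using image[of fst] by simp
  have snd: "AE \<omega> in P. simple_stable_integral m M s' \<omega>
      = (\<Sum>v\<in>(\<lambda>x. (s x, s' x)) ` space m - {0}. snd v * M {x \<in> space m. (s x, s' x) = v} \<omega>)"
    using image[of snd] by simp
  have "AE \<omega> in P. simple_stable_integral m M (\<lambda>x. a * s x + b * s' x) \<omega>
      = (\<Sum>v\<in>(\<lambda>x. (s x, s' x)) ` space m - {0}.
          (a * fst v + b * snd v) * M {x \<in> space m. (s x, s' x) = v} \<omega>)"
    using image[of "\<lambda>v. a * fst v + b * snd v"] by simp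
  with fst snd show ?thesis
    by eventually_elim (simp add: sum.distrib sum_distrib_left distrib_right mult.assoc)
qed

lemma has_stable_integral_measurable: "has_stable_integral P m \<alpha> M g Y \<Longrightarrow> Y \<in> borel_measurable P"
  and has_stable_integral_Lalpha: "has_stable_integral P m \<alpha> M g Y \<Longrightarrow> g \<in> Lalpha m \<alpha>"
  by (simp_all add: has_stable_integral_def)

lemma has_stable_integral_iff:
  "has_stable_integral P m \<alpha> M g Y \<longleftrightarrow> g \<in> Lalpha m \<alpha> \<and> Y \<in> borel_measurable P \<and>
     (\<exists>s :: nat \<Rightarrow> 'e \<Rightarrow> real. (\<forall>k. Bochner_Integration.simple_bochner_integrable m (s k)) \<and>
        (\<lambda>k. Lnorm m \<alpha> (\<lambda>x. s k x - g x)) \<longlonglongrightarrow> 0 \<and>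
        tendsto_in_probability P (\<lambda>k. simple_stable_integral m M (s k)) Y)"
proof -
  have "((\<lambda>k. \<integral>\<^sup>+ x. ennreal (\<bar>s k x - g x\<bar> powr \<alpha>) \<partial>m) \<longlonglongrightarrow> 0)
      \<longleftrightarrow> (\<lambda>k. Lnorm m \<alpha> (\<lambda>x. s k x - g x)) \<longlonglongrightarrow> 0"
    if "g \<in> Lalpha m \<alpha>" "\<And>k. Bochner_Integration.simple_bochner_integrable m (s k)" for s
    by (intro Lalpha_converges_iff Lalpha_diff index_gt_1 that(1)
        simple_bochner_integrable_imp_Lalpha[OF that(2)])
  then show ?thesis
    unfolding has_stable_integral_def by blast
qed

text \<open>The norms of approximating simple functions converge to that of \<open>g\<close> by the triangle inequality.\<close>

lemma has_stable_integral_law: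
  assumes "has_stable_integral P m \<alpha> M g Y"
  shows "\<exists>\<beta>'. has_stable_law P Y \<alpha> (Lnorm m \<alpha> g) \<beta>' 0"
proof -
  obtain s where g: "g \<in> Lalpha m \<alpha>" and Y: "Y \<in> borel_measurable P"
    and s: "\<And>k. Bochner_Integration.simple_bochner_integrable m (s k)"
    and lim: "(\<lambda>k. Lnorm m \<alpha> (\<lambda>x. s k x - g x)) \<longlonglongrightarrow> 0"
    and prob: "tendsto_in_probability P (\<lambda>k. simple_stable_integral m M (s k)) Y"
    using assms unfolding has_stable_integral_iff by auto
  have "(\<lambda>k. Lnorm m \<alpha> (s k) - Lnorm m \<alpha> g) \<longlonglongrightarrow> 0"
    by (rule Lim_null_comparison[OF _ lim])
       (use Lnorm_diff_triangle[OF index_gt_1 simple_bochner_integrable_imp_Lalpha[OF s] g] in simp)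
  then have "(\<lambda>k. Lnorm m \<alpha> (s k)) \<longlonglongrightarrow> Lnorm m \<alpha> g"
    by (simp add: LIM_zero_iff)
  then show ?thesis
    using simple_stable_integral_law[OF s] by (intro has_stable_law_limit[OF Y _ _ prob index_pos])
qed

lemma stable_scale_integral:
  "has_stable_integral P m \<alpha> M g Y \<Longrightarrow> stable_scale P \<alpha> Y = Lnorm m \<alpha> g"
  using has_stable_integral_law stable_scale_eq[OF index_pos] by blast

lemma has_stable_integral_lincomb:
  assumes g: "has_stable_integral P m \<alpha> M g Y" and h: "has_stable_integral P m \<alpha> M h Z"
  shows "has_stable_integral P m \<alpha> M (\<lambda>x. a * g x + b * h x) (\<lambda>\<omega>. a * Y \<omega> + b * Z \<omega>)"
proof -
  note [measurable] = has_stable_integral_measurable[OF g] has_stable_integral_measurable[OF h]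
  note gL = has_stable_integral_Lalpha[OF g] and hL = has_stable_integral_Lalpha[OF h]
  note gt1 = index_gt_1
  obtain s where s: "\<And>k. Bochner_Integration.simple_bochner_integrable m (s k)"
    and lim: "(\<lambda>k. Lnorm m \<alpha> (\<lambda>x. s k x - g x)) \<longlonglongrightarrow> 0"
    and prob: "tendsto_in_probability P (\<lambda>k. simple_stable_integral m M (s k)) Y"
    using g unfolding has_stable_integral_iff by auto
  obtain s' where s': "\<And>k. Bochner_Integration.simple_bochner_integrable m (s' k)"
    and lim': "(\<lambda>k. Lnorm m \<alpha> (\<lambda>x. s' k x - h x)) \<longlonglongrightarrow> 0"
    and prob': "tendsto_in_probability P (\<lambda>k. simple_stable_integral m M (s' k)) Z"
    using h unfolding has_stable_integral_iff by auto
  let ?s = "\<lambda>k x. a * s k x + b * s' k x"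
  have sL: "s k \<in> Lalpha m \<alpha>" and sL': "s' k \<in> Lalpha m \<alpha>" for k
    using s s' by (auto intro: simple_bochner_integrable_imp_Lalpha)
  have s_lin: "Bochner_Integration.simple_bochner_integrable m (?s k)" for k
    by (rule simple_bochner_integrable_compose2[OF _ s s']) simp
  have "(\<lambda>k. Lnorm m \<alpha> (\<lambda>x. ?s k x - (a * g x + b * h x))) \<longlonglongrightarrow> 0"
  proof (rule Lim_null_comparison)
    show "eventually (\<lambda>k. norm (Lnorm m \<alpha> (\<lambda>x. ?s k x - (a * g x + b * h x)))
      \<le> \<bar>a\<bar> * Lnorm m \<alpha> (\<lambda>x. s k x - g x) + \<bar>b\<bar> * Lnorm m \<alpha> (\<lambda>x. s' k x - h x)) sequentially"
    proof (intro always_eventually allI)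
      fix k
      have "Lnorm m \<alpha> (\<lambda>x. a * (s k x - g x) + b * (s' k x - h x))
          \<le> \<bar>a\<bar> * Lnorm m \<alpha> (\<lambda>x. s k x - g x) + \<bar>b\<bar> * Lnorm m \<alpha> (\<lambda>x. s' k x - h x)"
        using Lnorm_triangle[OF gt1 Lalpha_scale[OF Lalpha_diff[OF gt1 sL[of k] gL], of a]
            Lalpha_scale[OF Lalpha_diff[OF gt1 sL'[of k] hL], of b]]
        by (simp add: Lnorm_scale[OF gt1])
      then show "norm (Lnorm m \<alpha> (\<lambda>x. ?s k x - (a * g x + b * h x)))
        \<le> \<bar>a\<bar> * Lnorm m \<alpha> (\<lambda>x. s k x - g x) + \<bar>b\<bar> * Lnorm m \<alpha> (\<lambda>x. s' k x - h x)"
        by (simp add: algebra_simps)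
    qed
    show "(\<lambda>k. \<bar>a\<bar> * Lnorm m \<alpha> (\<lambda>x. s k x - g x) + \<bar>b\<bar> * Lnorm m \<alpha> (\<lambda>x. s' k x - h x)) \<longlonglongrightarrow> 0"
      using tendsto_add[OF tendsto_mult_left[OF lim, of "\<bar>a\<bar>"] tendsto_mult_left[OF lim', of "\<bar>b\<bar>"]]
      by simp
  qed
  moreover have "tendsto_in_probability P (\<lambda>k. simple_stable_integral m M (?s k)) (\<lambda>\<omega>. a * Y \<omega> + b * Z \<omega>)"
  proof (rule tendsto_in_probability_cong_AE)
    note [measurable] = simple_stable_integral_measurable[OF s] simple_stable_integral_measurable[OF s']
    show "AE \<omega> in P. a * simple_stable_integral m M (s k) \<omega> + b * simple_stable_integral m M (s' k) \<omega>
        = simple_stable_integral m M (?s k) \<omega>" for k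
      by (rule simple_stable_integral_lincomb[OF s s'])
    show "tendsto_in_probability P
        (\<lambda>k \<omega>. a * simple_stable_integral m M (s k) \<omega> + b * simple_stable_integral m M (s' k) \<omega>)
        (\<lambda>\<omega>. a * Y \<omega> + b * Z \<omega>)"
      by (intro tendsto_in_probability_add tendsto_in_probability_cmult prob prob') measurable
  qed (use simple_stable_integral_measurable[OF s_lin] simple_stable_integral_measurable[OF s]
      simple_stable_integral_measurable[OF s'] in measurable)
  ultimately show ?thesis
    unfolding has_stable_integral_iff
    using Lalpha_add[OF gt1 Lalpha_scale[OF gL, of a] Lalpha_scale[OF hL, of b]] s_lin
    by (intro conjI exI[of _ ?s]) auto
qed

lemma has_stable_integral_zero: "has_stable_integral P m \<alpha> M (\<lambda>_. 0) (\<lambda>_. 0)"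
proof -
  have "simple_stable_integral m M (\<lambda>_. 0) \<omega> = 0" for \<omega>
    unfolding simple_stable_integral_def by (rule sum.neutral) auto
  then have "tendsto_in_probability P (\<lambda>k. simple_stable_integral m M (\<lambda>_. 0)) (\<lambda>_. 0)"
    by (simp add: tendsto_in_probability_def)
  moreover have "Bochner_Integration.simple_bochner_integrable m (\<lambda>_. 0 :: real)"
    by (auto intro: Bochner_Integration.simple_bochner_integrable.intros)
  moreover have "Lnorm m \<alpha> (\<lambda>x. 0) = 0"
    using Lnorm_eq_0_iff[OF index_gt_1 Lalpha_zero] by simp
  ultimately show ?thesis
    unfolding has_stable_integral_iff
    by (intro conjI Lalpha_zero exI[of _ "\<lambda>_ _. 0"]) auto
qed

lemma has_stable_integral_sum:
  assumes "\<And>i. i \<in> I \<Longrightarrow> has_stable_integral P m \<alpha> M (g i) (Y i)"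
  shows "has_stable_integral P m \<alpha> M (\<lambda>x. \<Sum>i\<in>I. c i * g i x) (\<lambda>\<omega>. \<Sum>i\<in>I. c i * Y i \<omega>)"
  using assms
proof (induction I rule: infinite_finite_induct)
  case (insert i I)
  then have "has_stable_integral P m \<alpha> M (\<lambda>x. c i * g i x + 1 * (\<Sum>i\<in>I. c i * g i x))
      (\<lambda>\<omega>. c i * Y i \<omega> + 1 * (\<Sum>i\<in>I. c i * Y i \<omega>))"
    by (intro has_stable_integral_lincomb) auto
  then show ?case using insert by simp
qed (simp_all add: has_stable_integral_zero)

text \<open>The difference of two integrands integrates to \<open>0\<close>, which has scale \<open>0\<close>.\<close>

lemma integrand_unique:
  assumes g: "has_stable_integral P m \<alpha> M g Y" and h: "has_stable_integral P m \<alpha> M h Y"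
  shows "AE x in m. g x = h x"
proof -
  have "has_stable_integral P m \<alpha> M (\<lambda>x. g x - h x) (\<lambda>_. 0)"
    using has_stable_integral_lincomb[OF g h, of 1 "-1"] by simp
  then have "Lnorm m \<alpha> (\<lambda>x. g x - h x) = stable_scale P \<alpha> (\<lambda>_. 0)"
    using stable_scale_integral by simp
  also have "\<dots> = 0"
    by (rule stable_scale_eq[OF index_pos has_stable_law_scale_0_const])
  finally have "AE x in m. g x - h x = 0"
    using Lnorm_eq_0_iff[OF index_gt_1 Lalpha_diff[OF index_gt_1]]
      has_stable_integral_Lalpha[OF g] has_stable_integral_Lalpha[OF h] by blast
  then show ?thesis by simp
qed

lemma covariation_eq:
  assumes g: "has_stable_integral P m \<alpha> M g U" and h: "has_stable_integral P m \<alpha> M h V"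
  shows "covariation P m \<alpha> M U V = (LINT x|m. g x * signed_power (h x) (\<alpha> - 1))"
  unfolding covariation_def
proof (rule the_equality)
  fix c
  assume "\<exists>g h. has_stable_integral P m \<alpha> M g U \<and> has_stable_integral P m \<alpha> M h V \<and>
    c = (LINT x|m. g x * signed_power (h x) (\<alpha> - 1))"
  then obtain g' h' where g': "has_stable_integral P m \<alpha> M g' U"
    and h': "has_stable_integral P m \<alpha> M h' V"
    and c: "c = (LINT x|m. g' x * signed_power (h' x) (\<alpha> - 1))" by blast
  note [measurable] = has_stable_integral_Lalpha[OF g, THEN Lalpha_measurable]
    has_stable_integral_Lalpha[OF g', THEN Lalpha_measurable]
    has_stable_integral_Lalpha[OF h, THEN Lalpha_measurable]
    has_stable_integral_Lalpha[OF h', THEN Lalpha_measurable]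
  show "c = (LINT x|m. g x * signed_power (h x) (\<alpha> - 1))"
    unfolding c
  proof (rule integral_cong_AE)
    show "AE x in m. g' x * signed_power (h' x) (\<alpha> - 1) = g x * signed_power (h x) (\<alpha> - 1)"
      using integrand_unique[OF g' g] integrand_unique[OF h' h] by eventually_elim simp
  qed measurable
qed (use g h in blast)

end


section \<open>Full-dimensional vectors\<close>

text \<open>Centring preserves the linear relation, and row \<open>i\<close> of the product is the covariance of \<open>Y $ i\<close>
  with the left-hand side of the relation.\<close>

lemma (in prob_space) singular_covariance_matrix:
  fixes Y :: "'a \<Rightarrow> real ^ 'n"
  assumes Y: "Y \<in> borel_measurable M" and sq: "\<And>i. integrable M (\<lambda>\<omega>. (Y \<omega> $ i)\<^sup>2)"
    and zero: "AE \<omega> in M. v \<bullet> Y \<omega> = 0"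
  shows "covariance_matrix M Y *v v = 0"
proof -
  have meas: "(\<lambda>\<omega>. Y \<omega> $ i) \<in> borel_measurable M" for i
    by (rule measurable_compose[OF Y]) (intro borel_measurable_continuous_onI continuous_intros)
  have int: "integrable M (\<lambda>\<omega>. Y \<omega> $ i)" for i
    by (rule square_integrable_imp_integrable[OF meas sq])
  let ?Z = "\<lambda>i \<omega>. Y \<omega> $ i - (LINT \<omega>'|M. Y \<omega>' $ i)"
  have Z_sq: "integrable M (\<lambda>\<omega>. (?Z i \<omega>)\<^sup>2)" for i
    using int sq by (simp add: power2_diff)
  have ZZ: "integrable M (\<lambda>\<omega>. ?Z i \<omega> * ?Z j \<omega>)" for i j
  proof (rule Bochner_Integration.integrable_bound)
    show "integrable M (\<lambda>\<omega>. (?Z i \<omega>)\<^sup>2 + (?Z j \<omega>)\<^sup>2)" using Z_sq by simp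
    show "(\<lambda>\<omega>. ?Z i \<omega> * ?Z j \<omega>) \<in> borel_measurable M"
      using meas by measurable
    have "\<bar>x * y\<bar> \<le> \<bar>x\<^sup>2 + y\<^sup>2\<bar>" for x y :: real
    proof -
      have "0 \<le> \<bar>x\<bar> * \<bar>y\<bar>" by simp
      then have "\<bar>x\<bar> * \<bar>y\<bar> \<le> x\<^sup>2 + y\<^sup>2"
        using sum_squares_bound[of "\<bar>x\<bar>" "\<bar>y\<bar>"] unfolding power2_abs by linarith
      then show ?thesis by (simp add: abs_mult)
    qed
    then show "AE \<omega> in M. norm (?Z i \<omega> * ?Z j \<omega>) \<le> norm ((?Z i \<omega>)\<^sup>2 + (?Z j \<omega>)\<^sup>2)"
      by (intro AE_I2) (simp only: real_norm_def)
  qed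
  have v_Y: "v \<bullet> Y \<omega> = (\<Sum>j\<in>UNIV. v $ j * Y \<omega> $ j)" for \<omega>
    by (simp add: inner_vec_def)
  have "(\<Sum>j\<in>UNIV. v $ j * (LINT \<omega>|M. Y \<omega> $ j)) = (LINT \<omega>|M. v \<bullet> Y \<omega>)"
    unfolding v_Y using int by simp
  also have "\<dots> = 0"
    using zero by (rule integral_eq_zero_AE)
  finally have mean: "(\<Sum>j\<in>UNIV. v $ j * (LINT \<omega>|M. Y \<omega> $ j)) = 0" .
  have Z0: "AE \<omega> in M. (\<Sum>j\<in>UNIV. v $ j * ?Z j \<omega>) = 0"
    using zero
  proof eventually_elim
    case (elim \<omega>)
    have "(\<Sum>j\<in>UNIV. v $ j * ?Z j \<omega>)
        = v \<bullet> Y \<omega> - (\<Sum>j\<in>UNIV. v $ j * (LINT \<omega>|M. Y \<omega> $ j))"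
      unfolding v_Y by (simp only: right_diff_distrib sum_subtractf)
    then show ?case unfolding mean elim by simp
  qed
  have "(covariance_matrix M Y *v v) $ i = 0" for i
  proof -
    have "(covariance_matrix M Y *v v) $ i = (\<Sum>j\<in>UNIV. (LINT \<omega>|M. ?Z i \<omega> * ?Z j \<omega>) * v $ j)"
      by (simp add: matrix_vector_mult_def covariance_matrix_def)
    also have "\<dots> = (LINT \<omega>|M. (\<Sum>j\<in>UNIV. ?Z i \<omega> * ?Z j \<omega> * v $ j))"
      using ZZ by simp
    also have "\<dots> = (LINT \<omega>|M. ?Z i \<omega> * (\<Sum>j\<in>UNIV. v $ j * ?Z j \<omega>))"
      by (simp only: sum_distrib_left ac_simps)
    also have "\<dots> = 0"
      using Z0 by (intro integral_eq_zero_AE) auto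
    finally show ?thesis .
  qed
  then show ?thesis by (simp add: vec_eq_iff)
qed

text \<open>As \<open>v \<bullet> Y\<close> vanishes, the characteristic function of \<open>Y\<close> at \<open>v\<close> is \<open>1\<close>. Taking the modulus removes the shift and
  the skewness term, and leaves that \<open>\<bar>v \<bullet> s\<bar> powr \<alpha>\<close> integrates to \<open>0\<close> under the spectral measure.\<close>

lemma (in prob_space) spectral_measure_hyperplane:
  fixes Y :: "'a \<Rightarrow> real ^ 'n"
  assumes \<alpha>: "0 < \<alpha>" and spectral: "is_spectral_measure M \<alpha> Y \<Gamma>"
    and Y: "Y \<in> borel_measurable M" and zero: "AE \<omega> in M. v \<bullet> Y \<omega> = 0"
  shows "emeasure \<Gamma> (sphere 0 1 - {x. v \<bullet> x = 0}) = 0"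
proof -
  interpret G: finite_measure \<Gamma> using spectral by (simp add: is_spectral_measure_def)
  have sets: "sets \<Gamma> = sets (restrict_space borel (sphere (0 :: real ^ 'n) 1))"
    using spectral by (simp add: is_spectral_measure_def)
  have space: "space \<Gamma> = sphere 0 1"
    using sets_eq_imp_space_eq[OF sets] by (simp add: space_restrict_space)
  have meas: "h \<in> borel_measurable \<Gamma>" if "h \<in> borel_measurable borel" for h :: "real ^ 'n \<Rightarrow> 'c::topological_space"
    unfolding measurable_cong_sets[OF sets refl] by (rule measurable_restrict_space1[OF that])
  let ?T = "tan (pi * \<alpha> / 2)"
  let ?g = "\<lambda>s. complex_of_real (\<bar>v \<bullet> s\<bar> powr \<alpha>) * (1 - \<i> * complex_of_real (sgn (v \<bullet> s) * ?T))"
  obtain \<mu> where \<mu>: "(CLINT \<omega>|M. iexp (v \<bullet> Y \<omega>))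
      = exp (- (CLINT s|\<Gamma>. ?g s) + \<i> * complex_of_real (v \<bullet> \<mu>))"
    using spectral by (auto simp: is_spectral_measure_def)
  have "(CLINT \<omega>|M. iexp (v \<bullet> Y \<omega>)) = (CLINT \<omega>|M. 1)"
  proof (rule integral_cong_AE)
    show "AE \<omega> in M. iexp (v \<bullet> Y \<omega>) = 1" using zero by eventually_elim simp
    show "(\<lambda>\<omega>. iexp (v \<bullet> Y \<omega>)) \<in> borel_measurable M" using Y by measurable
  qed simp
  then have "norm (exp (- (CLINT s|\<Gamma>. ?g s) + \<i> * complex_of_real (v \<bullet> \<mu>))) = 1"
    unfolding \<mu> by (simp add: prob_space)
  then have Re0: "Re (CLINT s|\<Gamma>. ?g s) = 0" by (simp add: norm_exp_eq_Re)
  have "(\<lambda>s. v \<bullet> s) \<in> borel_measurable borel" by measurable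
  then have g_meas: "?g \<in> borel_measurable \<Gamma>"
    unfolding sgn_if by (intro meas) measurable
  have bound: "norm (?g s) \<le> norm v powr \<alpha> * (1 + \<bar>?T\<bar>)" if "s \<in> space \<Gamma>" for s
  proof -
    have "\<bar>v \<bullet> s\<bar> \<le> norm v"
      using that Cauchy_Schwarz_ineq2[of v s] by (simp add: space)
    then have "\<bar>v \<bullet> s\<bar> powr \<alpha> \<le> norm v powr \<alpha>"
      using \<alpha> by (intro powr_mono2) auto
    moreover have "norm (1 - \<i> * complex_of_real (sgn (v \<bullet> s) * ?T)) \<le> 1 + \<bar>?T\<bar>"
    proof -
      have "norm (1 - \<i> * complex_of_real (sgn (v \<bullet> s) * ?T))
          \<le> 1 + \<bar>sgn (v \<bullet> s) * ?T\<bar>"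
        using norm_triangle_ineq4[of 1 "\<i> * complex_of_real (sgn (v \<bullet> s) * ?T)"]
        by (simp only: norm_mult norm_ii norm_of_real norm_one mult_1)
      also have "\<dots> \<le> 1 + \<bar>?T\<bar>" by (simp add: abs_mult sgn_if)
      finally show ?thesis .
    qed
    moreover have "norm (?g s)
        = \<bar>v \<bullet> s\<bar> powr \<alpha> * norm (1 - \<i> * complex_of_real (sgn (v \<bullet> s) * ?T))"
      by (simp only: norm_mult norm_of_real abs_of_nonneg powr_ge_zero)
    ultimately show ?thesis
      by (simp only:) (intro mult_mono; simp)
  qed
  have g_int: "complex_integrable \<Gamma> ?g"
    by (rule G.integrable_const_bound[OF AE_I2[OF bound] g_meas])
  have "integrable \<Gamma> (\<lambda>s. Re (?g s))" "(LINT s|\<Gamma>. Re (?g s)) = Re (CLINT s|\<Gamma>. ?g s)"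
    using integrable_Re[OF g_int] integral_Re[OF g_int] by auto
  moreover have "Re (?g s) = \<bar>v \<bullet> s\<bar> powr \<alpha>" for s by simp
  ultimately have int: "integrable \<Gamma> (\<lambda>s. \<bar>v \<bullet> s\<bar> powr \<alpha>)"
    and "(LINT s|\<Gamma>. \<bar>v \<bullet> s\<bar> powr \<alpha>) = 0"
    using Re0 by (simp_all only:)
  then have "AE s in \<Gamma>. \<bar>v \<bullet> s\<bar> powr \<alpha> = 0"
    by (subst integral_nonneg_eq_0_iff_AE[OF int, symmetric]) simp_all
  then have "AE s in \<Gamma>. \<not> v \<bullet> s \<noteq> 0" by simp
  then have "emeasure \<Gamma> {s \<in> space \<Gamma>. v \<bullet> s \<noteq> 0} = 0" by (rule emeasure_eq_0_AE)
  moreover have "{s \<in> space \<Gamma>. v \<bullet> s \<noteq> 0} = sphere 0 1 - {x. v \<bullet> x = 0}"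
    by (auto simp: space)
  ultimately show ?thesis by simp
qed

text \<open>A nontrivial linear relation between the components makes the covariance matrix singular and
  concentrates every spectral measure on a hyperplane, so full dimension excludes it.\<close>

lemma (in prob_space) full_dimensional_nondegenerate:
  fixes Y :: "'a \<Rightarrow> real ^ 'n"
  assumes \<alpha>: "0 < \<alpha>" and full: "full_dimensional M \<alpha> Y"
    and sq: "\<And>i. \<alpha> = 2 \<Longrightarrow> integrable M (\<lambda>\<omega>. (Y \<omega> $ i)\<^sup>2)"
    and zero: "AE \<omega> in M. v \<bullet> Y \<omega> = 0"
  shows "v = 0"
proof (cases "\<alpha> = 2")
  case True
  have Y: "Y \<in> borel_measurable M" and "invertible (covariance_matrix M Y)"
    using full True by (simp_all add: full_dimensional_def)
  then obtain B where "B ** covariance_matrix M Y = mat 1" by (auto simp: invertible_def)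
  then have "v = B *v (covariance_matrix M Y *v v)" by (simp add: matrix_vector_mul_assoc)
  also have "\<dots> = 0"
    using singular_covariance_matrix[OF Y sq[OF True] zero] by simp
  finally show ?thesis .
next
  case False
  then obtain \<Gamma> where Y: "Y \<in> borel_measurable M" and spectral: "is_spectral_measure M \<alpha> Y \<Gamma>"
    and not_conc: "\<And>H. subspace H \<Longrightarrow> dim H = CARD('n) - 1 \<Longrightarrow> emeasure \<Gamma> (sphere 0 1 - H) \<noteq> 0"
    using full by (auto simp: full_dimensional_def)
  show ?thesis
  proof (rule ccontr)
    assume "v \<noteq> 0"
    then have "dim {x. v \<bullet> x = 0} = CARD('n) - 1" using dim_hyperplane[of v] by simp
    then show False
      using not_conc[OF subspace_hyperplane] spectral_measure_hyperplane[OF \<alpha> spectral Y zero] by blast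
  qed
qed

section \<open>The predictor as a maximizer\<close>

context stable_random_measure
begin

lemma linear_predictor_has_integral:
  assumes X: "\<And>s. has_stable_integral P m \<alpha> M (f s) (X s)"
  shows "has_stable_integral P m \<alpha> M (\<lambda>x. \<Sum>i\<in>UNIV. v $ i * f (t i) x) (linear_predictor X t v)"
proof -
  have "linear_predictor X t v = (\<lambda>\<omega>. \<Sum>i\<in>UNIV. v $ i * X (t i) \<omega>)"
    by (simp add: fun_eq_iff linear_predictor_def)
  then show ?thesis using has_stable_integral_sum[of UNIV "\<lambda>i. f (t i)" "\<lambda>i. X (t i)"] X by simp
qed

text \<open>Minkowski's inequality and strict convexity are inherited from the integrands. Definiteness is where full
  dimension enters.\<close>

lemma predictor_norm:
  fixes X :: "real ^ 'd \<Rightarrow> 'w \<Rightarrow> real" and t :: "'n::finite \<Rightarrow> real ^ 'd"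
  assumes X: "\<And>s. has_stable_integral P m \<alpha> M (f s) (X s)"
    and full: "full_dimensional P \<alpha> (\<lambda>\<omega>. \<chi> i. X (t i) \<omega>)"
  shows "strictly_convex_norm (\<lambda>v :: real ^ 'n. Lnorm m \<alpha> (\<lambda>x. \<Sum>i\<in>UNIV. v $ i * f (t i) x))"
proof -
  let ?g = "\<lambda>(v :: real ^ 'n) x. \<Sum>i\<in>UNIV. v $ i * f (t i) x"
  let ?N = "\<lambda>v. Lnorm m \<alpha> (?g v)"
  have L: "?g v \<in> Lalpha m \<alpha>" for v
    by (rule has_stable_integral_Lalpha[OF linear_predictor_has_integral[OF X]])
  have add: "?g (u + v) = (\<lambda>x. ?g u x + ?g v x)" for u v
    by (simp add: fun_eq_iff distrib_right sum.distrib)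
  have diff: "?g (u - v) = (\<lambda>x. ?g u x - ?g v x)" for u v
    by (simp add: fun_eq_iff left_diff_distrib sum_subtractf)
  have pos: "0 < ?N v" if "v \<noteq> 0" for v
  proof (rule ccontr)
    assume "\<not> 0 < ?N v"
    then have "?N v = 0" using Lnorm_nonneg[of m \<alpha> "?g v"] by linarith
    then obtain \<beta>' where "has_stable_law P (linear_predictor X t v) \<alpha> 0 \<beta>' 0"
      using has_stable_integral_law[OF linear_predictor_has_integral[where X = X and v = v and t = t, OF X]]
      by auto
    then have "AE \<omega> in P. linear_predictor X t v \<omega> = 0"
      by (rule has_stable_law_scale_0)
    then have zero: "AE \<omega> in P. v \<bullet> (\<chi> i. X (t i) \<omega>) = 0"
      by (simp add: linear_predictor_def inner_vec_def)
    have "integrable P (\<lambda>\<omega>. ((\<chi> i. X (t i) \<omega>) $ i)\<^sup>2)" if "\<alpha> = 2" for i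
      using has_stable_integral_law[OF X, of "t i"] gaussian_square_integrable that by auto
    then have "v = 0"
      by (rule full_dimensional_nondegenerate[OF index_pos full _ zero])
    then show False using that by simp
  qed
  show ?thesis
  proof
    show "?N (c *\<^sub>R v) = \<bar>c\<bar> * ?N v" for c v
      by (simp add: mult.assoc Lnorm_scale[OF index_gt_1] flip: sum_distrib_left)
    show "?N (u + v) \<le> ?N u + ?N v" for u v
      unfolding add by (rule Lnorm_triangle[OF index_gt_1 L L])
    show "0 < ?N v" if "v \<noteq> 0" for v using pos[OF that] .
    show "?N (u + v) < 2 * ?N u" if "?N u = ?N v" "u \<noteq> v" for u v
      unfolding add
    proof (rule Lnorm_strict_convex[OF index_gt_1 L L that(1)])
      show "Lnorm m \<alpha> (\<lambda>x. ?g u x - ?g v x) \<noteq> 0"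
        using pos[of "u - v"] that(2) unfolding diff by simp
    qed
  qed
qed

lemma covariation_linear_predictor:
  assumes X: "\<And>s. has_stable_integral P m \<alpha> M (f s) (X s)"
  shows "covariation P m \<alpha> M (linear_predictor X t v) (X s)
    = (\<chi> i. covariation P m \<alpha> M (X (t i)) (X s)) \<bullet> v"
proof -
  note L = has_stable_integral_Lalpha[OF X]
  have "covariation P m \<alpha> M (linear_predictor X t v) (X s)
      = (LINT x|m. (\<Sum>i\<in>UNIV. v $ i * f (t i) x) * signed_power (f s x) (\<alpha> - 1))"
    by (rule covariation_eq[OF linear_predictor_has_integral[OF X] X])
  also have "\<dots> = (LINT x|m. (\<Sum>i\<in>UNIV. v $ i * (f (t i) x * signed_power (f s x) (\<alpha> - 1))))"
    by (simp only: sum_distrib_right mult.assoc)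
  also have "\<dots> = (\<Sum>i\<in>UNIV. v $ i * (LINT x|m. f (t i) x * signed_power (f s x) (\<alpha> - 1)))"
    using integrable_mult_signed_power[OF index_gt_1 L L] by simp
  also have "\<dots> = (\<chi> i. covariation P m \<alpha> M (X (t i)) (X s)) \<bullet> v"
    by (simp add: covariation_eq[OF X X] inner_vec_def mult.commute)
  finally show ?thesis .
qed

end

theorem theorem14:
  fixes P :: "'w measure" and m :: "'e measure" and \<alpha> :: real and \<beta> :: "'e \<Rightarrow> real"
    and M :: "'e set \<Rightarrow> 'w \<Rightarrow> real"
    and f :: "real ^ 'd \<Rightarrow> 'e \<Rightarrow> real" and X :: "real ^ 'd \<Rightarrow> 'w \<Rightarrow> real"
    and \<kappa> :: "real ^ 'd \<Rightarrow> real ^ 'd \<Rightarrow> real"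
    and t :: "'n::finite \<Rightarrow> real ^ 'd" and t0 :: "real ^ 'd"
  assumes M: "stable_random_measure P m \<alpha> \<beta> M"
    and X: "\<And>s. has_stable_integral P m \<alpha> M (f s) (X s)"
    and \<kappa>: "\<And>s r. \<kappa> s r = covariation P m \<alpha> M (X s) (X r)"
    and distinct: "inj t"
    and full_dim: "full_dimensional P \<alpha> (\<lambda>\<omega>. \<chi> i. X (t i) \<omega>)"
  shows "(\<exists>w. is_mcl_weights P m \<alpha> M X t t0 w) \<and>
    ((\<exists>i. \<kappa> (t i) t0 \<noteq> 0) \<longrightarrow> (\<exists>!w. is_mcl_weights P m \<alpha> M X t t0 w)) \<and>
    ((\<exists>!w. is_mcl_weights P m \<alpha> M X t t0 w) \<longrightarrow>
       (\<forall>w. is_mcl_weights P m \<alpha> M X t t0 w \<longrightarrow> (\<exists>i. t0 = t i) \<longrightarrow>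
          (AE \<omega> in P. linear_predictor X t w \<omega> = X t0 \<omega>))) \<and>
    ((\<exists>i. \<kappa> (t i) t0 \<noteq> 0) \<and> continuous_on UNIV (\<lambda>(s, r). \<kappa> s r) \<longrightarrow>
       (\<forall>w :: real ^ 'd \<Rightarrow> real ^ 'n. (\<forall>s. is_mcl_weights P m \<alpha> M X t s (w s)) \<longrightarrow>
          (\<forall>i. isCont (\<lambda>s. w s $ i) t0)))"
proof -
  interpret stable_random_measure P m \<alpha> \<beta> M by (fact M)
  let ?g = "\<lambda>(v :: real ^ 'n) x. \<Sum>i\<in>UNIV. v $ i * f (t i) x"
  let ?N = "\<lambda>v. Lnorm m \<alpha> (?g v)"
  interpret N: strictly_convex_norm ?N by (rule predictor_norm[OF X full_dim])
  let ?l = "\<lambda>s. \<chi> i. \<kappa> (t i) s"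
  let ?r = "\<lambda>s. Lnorm m \<alpha> (f s)"
  note L = has_stable_integral_Lalpha[OF X]
    and gL = has_stable_integral_Lalpha[OF linear_predictor_has_integral[OF X]]
  have cov: "covariation P m \<alpha> M (linear_predictor X t v) (X s) = ?l s \<bullet> v" for v s
    unfolding \<kappa> by (rule covariation_linear_predictor[OF X])
  have scale: "stable_scale P \<alpha> (linear_predictor X t v) = ?N v" for v
    by (rule stable_scale_integral[OF linear_predictor_has_integral[OF X]])
  have mcl: "is_mcl_weights P m \<alpha> M X t s w \<longleftrightarrow> N.maximizes (?l s) (?r s) w" for s w
    unfolding is_mcl_weights_def N.maximizes_def cov scale stable_scale_integral[OF X] ..
  have \<kappa>_self: "\<kappa> s s = ?r s powr \<alpha>" for s
    unfolding \<kappa> covariation_eq[OF X X] by (rule integral_self_signed_power[OF index_gt_1])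

  have ex: "\<exists>w. is_mcl_weights P m \<alpha> M X t t0 w"
    unfolding mcl by (rule N.ex_maximizes) simp
  have l_nonzero: "?l t0 \<noteq> 0" if "\<exists>i. \<kappa> (t i) t0 \<noteq> 0"
    using that by (auto simp: vec_eq_iff)
  have unique: "\<exists>!w. is_mcl_weights P m \<alpha> M X t t0 w" if "\<exists>i. \<kappa> (t i) t0 \<noteq> 0"
    using ex N.maximizes_unique[of "?l t0" "?r t0"] l_nonzero[OF that] unfolding mcl by blast
  have exact: "AE \<omega> in P. linear_predictor X t w \<omega> = X t0 \<omega>"
    if uniq: "\<exists>!w. is_mcl_weights P m \<alpha> M X t t0 w" and w: "is_mcl_weights P m \<alpha> M X t t0 w"
      and i: "t0 = t i" for w i
  proof -
    let ?e = "axis i 1 :: real ^ 'n"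
    have select: "(\<Sum>j\<in>UNIV. ?e $ j * h j) = h i" for h :: "'n \<Rightarrow> real"
      by (simp add: axis_def if_distrib[of "\<lambda>c. c * _"] cong: if_cong)
    have g_e: "?g ?e = f t0" by (simp only: select i)
    \<comment> \<open>among functions of the norm of \<open>f t0\<close>, the covariation on \<open>X t0\<close> is largest for \<open>f t0\<close> itself\<close>
    have "N.maximizes (?l t0) (?r t0) ?e"
      unfolding N.maximizes_iff
    proof (intro conjI allI impI)
      show "?N ?e = ?r t0" by (simp only: g_e)
      fix v assume v: "?N v = ?r t0"
      have "?l t0 \<bullet> v = (LINT x|m. ?g v x * signed_power (f t0 x) (\<alpha> - 1))"
        unfolding cov[symmetric] by (rule covariation_eq[OF linear_predictor_has_integral[OF X] X])
      also have "\<dots> \<le> ?r t0 powr \<alpha>"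
        by (rule integral_mult_signed_power_le[OF index_gt_1 gL L v])
      also have "\<dots> = ?l t0 \<bullet> ?e"
        using \<kappa>_self[of t0] i by (simp add: inner_axis)
      finally show "?l t0 \<bullet> v \<le> ?l t0 \<bullet> ?e" .
    qed
    then have "w = ?e" using uniq w unfolding mcl by blast
    then have "linear_predictor X t w \<omega> = X t0 \<omega>" for \<omega>
      by (simp only: linear_predictor_def select i)
    then show ?thesis by simp
  qed
  have cont: "isCont (\<lambda>s. w s $ i) t0"
    if ne: "\<exists>i. \<kappa> (t i) t0 \<noteq> 0" and \<kappa>_cont: "continuous_on UNIV (\<lambda>(s, r). \<kappa> s r)"
      and w: "\<And>s. is_mcl_weights P m \<alpha> M X t s (w s)" for w :: "real ^ 'd \<Rightarrow> real ^ 'n" and i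
  proof -
    have \<kappa>_comp: "isCont (\<lambda>s. \<kappa> (a s) (b s)) t0" if "isCont a t0" "isCont b t0"
      for a b :: "real ^ 'd \<Rightarrow> real ^ 'd"
    proof -
      have "isCont (\<lambda>(s, r). \<kappa> s r) (a t0, b t0)"
        using \<kappa>_cont by (simp add: continuous_on_eq_continuous_at)
      then show ?thesis
        using isCont_o2[OF isCont_Pair[OF that], of "\<lambda>(s, r). \<kappa> s r"] by simp
    qed
    have "isCont w t0"
    proof (rule N.maximizes_continuous)
      show "N.maximizes (?l s) (?r s) (w s)" for s using w[of s] unfolding mcl .
      show "isCont ?l t0"
        unfolding continuous_def
        by (rule vec_tendstoI) (use \<kappa>_comp[of "\<lambda>_. t _" "\<lambda>s. s"] in \<open>simp add: continuous_def\<close>)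
      have "isCont (\<lambda>s. \<kappa> s s powr (1 / \<alpha>)) t0"
        using \<kappa>_comp[of "\<lambda>s. s" "\<lambda>s. s"] index_pos unfolding isCont_def
        by (intro tendsto_powr') (auto simp: \<kappa>_self)
      then show "isCont ?r t0"
        using index_pos by (simp add: \<kappa>_self powr_powr)
      show "?l t0 \<noteq> 0 \<or> ?r t0 = 0" using l_nonzero[OF ne] by blast
    qed
    then show ?thesis by (rule isCont_vec_nth)
  qed
  show ?thesis using ex unique exact cont by blast
qed

end
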